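(* Consider the Bernoulli-arrival QBD (quasi-birth-death) model described in the context for a two-node slotted Aloha network without exponential backoff ($n=2$, $K=0$), with transmission probabilities $p_1,p_2$ and arrival rates $\lambda_1,\lambda_2$. For $\{i,j\}=\{1,2\}$, the border of instability of node $N_i$, namely $\lambda_i^{SR}(\lambda_j)=\sum_{h=1}^2\boldsymbol\alpha(h)p_i^{suc}(h)$ computed with $N_i$ saturated, is $$\lambda_i^{SR}(\lambda_j)=p_i\left(1-\frac{\lambda_j}{1-p_i}\right).$$ Consequently the stability region given by the model, $SR=\{(\lambda_1,\lambda_2)\mid\lambda_1<\lambda_1^{SR}(\lambda_2),\ \lambda_2<\lambda_2^{SR}(\lambda_1)\}$, is $$SR=\left\{(\lambda_1,\lambda_2)\ \middle|\ \lambda_1<p_1\Big(1-\frac{\lambda_2}{1-p_1}\Big),\ \lambda_2<p_2\Big(1-\frac{\lambda_1}{1-p_2}\Big)\right\},$$ and this equals the exact stability region of the two-node slotted Aloha network without exponential backoff.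
   Context: Two nodes $N_1,N_2$ have infinite buffers and independent Bernoulli arrivals with rates $\lambda_1,\lambda_2$; in each slot a node $N_k$ with non-empty queue transmits with probability $p_k$; a transmission succeeds if and only if the other node does not transmit. The exact stability region of this network is the set of arrival rate pairs for which the queues are stable (balanced input and output rates at both nodes). $I(\cdot)$ is the indicator function. The model: for $\{i,j\}=\{1,2\}$, the Markov chain $MC_i$ has states $(q_i,\hat q_j)$, with $q_i\in\{0,1,2,\dots\}$ (the level: queue length of $N_i$) and $\hat q_j\in\{0,1\}$ (the phase: whether the queue of $N_j$ is non-empty). Phase $h=1$ is $\hat q_j=0$ and phase $h=2$ is $\hat q_j=1$. One step of $MC_i$: independently, $N_i$ transmits with probability $p_iI(q_i>0)$ and $N_j$ transmits with probability $p_jI(\hat q_j=1)$. If only $N_i$ transmits, $q_i$ decreases by one; if only $N_j$ transmits, then $\hat q_j$ is changed to $0$ with probability $z_j$ and left at $1$ with probability $1-z_j$, where $z_j$ is the conditional probability that $N_j$ has exactly one packet given that its queue is non-empty; otherwise nothing departs. Afterwards, independently, $q_i$ increases by one with probability $\lambda_i$, and with probability $\lambda_j$ an arrival to $N_j$ sets $\hat q_j=1$. For $\ell\ge2$, the ($\ell$-independent) probabilities of going from phase $h$ of level $\ell$ to phase $h'$ of level $\ell+1,\ell,\ell-1$ are the $(h,h')$ entries of the $2\times2$ matrices $A_0,A_1,A_2$ of $MC_i$; $A=A_0+A_1+A_2$, and $\boldsymbol\alpha$ is the stationary probability vector of $A$. $p_i^{suc}(h)=p_i(1-p_jI(h=2))$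 is the probability of a successful transmission of $N_i$ in phase $h$ of a level $\ell\ge2$. "$N_i$ saturated" means that $N_i$ always has packets and has probability zero of holding a finite number of packets. In the model, $A$ is then formed with $z_j=\pi_j(1)/(1-\pi_j(0))$, where $\pi_j(\ell)$ is the stationary probability of level $\ell$ of $MC_j$ formed with $z_i=0$; in $MC_j$ the states with $\hat q_i=0$ are then transient, so that $MC_j$ becomes a one-dimensional Markov chain.
   Formalization: The border formula is claimed only for λ_j ≤ p_j(1−p_i) (beyond it MC_j has no stationary distribution), and the closed form of SR only for p_1+p_2 ≤ 1 (it fails otherwise); 0<p_k<1 is assumed, and SR equals the exact region for all such p_1, p_2. *)

theory Defs
  imports "HOL-Probability.Probability"
begin

text \<open>Phases are the indices \<open>1, 2 :: 2\<close> of the library's 2-dimensional vectors (the numeral type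
  \<open>2\<close>, in which \<open>1 \<noteq> 2\<close>): phase 1 means that the queue of the other node is empty, phase 2 that it
  is non-empty.\<close>

type_synonym phase = 2

text \<open>The argument order is always (own node, other node): the chain \<open>MC\<^sub>i\<close> is
  \<open>mc_step \<lambda>\<^sub>i p\<^sub>i \<lambda>\<^sub>j p\<^sub>j z\<^sub>j\<close>, and exchanging the roles of the nodes gives \<open>MC\<^sub>j\<close>.\<close>

definition mc_step ::
  "real \<Rightarrow> real \<Rightarrow> real \<Rightarrow> real \<Rightarrow> real \<Rightarrow> nat \<times> phase \<Rightarrow> (nat \<times> phase) pmf" where
  "mc_step lam_i p_i lam_j p_j z_j = (\<lambda>(q, h).
     do {
       ti \<leftarrow> bernoulli_pmf (p_i * of_bool (q > 0));
       tj \<leftarrow> bernoulli_pmf (p_j * of_bool (h = 2));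
       only \<leftarrow> bernoulli_pmf z_j;
       ai \<leftarrow> bernoulli_pmf lam_i;
       aj \<leftarrow> bernoulli_pmf lam_j;
       let q' = (if ti \<and> \<not> tj then q - 1 else q);
       let h' = (if tj \<and> \<not> ti \<and> only then 1 else h);
       return_pmf (if ai then q' + 1 else q', if aj then 2 else h')
     })"

definition level_block ::
  "real \<Rightarrow> real \<Rightarrow> real \<Rightarrow> real \<Rightarrow> real \<Rightarrow> nat \<Rightarrow> nat \<Rightarrow> real^2^2" where
  "level_block lam_i p_i lam_j p_j z_j l l' =
     (\<chi> h h'. pmf (mc_step lam_i p_i lam_j p_j z_j (l, h)) (l', h'))"

text \<open>The blocks do not depend on the level \<open>l \<ge> 2\<close> (lemma \<open>level_block_indep\<close> below), so they
  are read off at level 2.\<close>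

definition A0 :: "real \<Rightarrow> real \<Rightarrow> real \<Rightarrow> real \<Rightarrow> real \<Rightarrow> real^2^2" where
  "A0 lam_i p_i lam_j p_j z_j = level_block lam_i p_i lam_j p_j z_j 2 3"

definition A1 :: "real \<Rightarrow> real \<Rightarrow> real \<Rightarrow> real \<Rightarrow> real \<Rightarrow> real^2^2" where
  "A1 lam_i p_i lam_j p_j z_j = level_block lam_i p_i lam_j p_j z_j 2 2"

definition A2 :: "real \<Rightarrow> real \<Rightarrow> real \<Rightarrow> real \<Rightarrow> real \<Rightarrow> real^2^2" where
  "A2 lam_i p_i lam_j p_j z_j = level_block lam_i p_i lam_j p_j z_j 2 1"

definition A_mat :: "real \<Rightarrow> real \<Rightarrow> real \<Rightarrow> real \<Rightarrow> real \<Rightarrow> real^2^2" where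
  "A_mat lam_i p_i lam_j p_j z_j =
     A0 lam_i p_i lam_j p_j z_j + A1 lam_i p_i lam_j p_j z_j + A2 lam_i p_i lam_j p_j z_j"

definition stationary_vec :: "real^2^2 \<Rightarrow> real^2 \<Rightarrow> bool" where
  "stationary_vec A \<alpha> \<longleftrightarrow> (\<forall>h. 0 \<le> \<alpha> $ h) \<and> (\<Sum>h\<in>UNIV. \<alpha> $ h) = 1 \<and> \<alpha> v* A = \<alpha>"

definition p_suc :: "real \<Rightarrow> real \<Rightarrow> phase \<Rightarrow> real" where
  "p_suc p_i p_j h = p_i * (1 - p_j * of_bool (h = 2))"

text \<open>Stationary distributions of \<open>MC\<^sub>j\<close> formed with \<open>z\<^sub>i = 0\<close>. Now \<open>N\<^sub>j\<close> is the own node, and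
  phase 1 is the phase in which \<open>N\<^sub>i\<close> is empty. A saturated \<open>N\<^sub>i\<close> always has packets, so that phase
  carries no mass. For \<open>\<lambda>\<^sub>i > 0\<close> this is automatic, since the phase is then transient; for
  \<open>\<lambda>\<^sub>i = 0\<close> it selects the one-dimensional chain.\<close>

definition sat_stationary ::
  "real \<Rightarrow> real \<Rightarrow> real \<Rightarrow> real \<Rightarrow> (nat \<times> phase) pmf \<Rightarrow> bool" where
  "sat_stationary lam_i p_i lam_j p_j \<pi> \<longleftrightarrow>
     bind_pmf \<pi> (mc_step lam_j p_j lam_i p_i 0) = \<pi> \<and> (\<forall>l. pmf \<pi> (l, 1) = 0)"

definition level_prob :: "(nat \<times> phase) pmf \<Rightarrow> nat \<Rightarrow> real" where
  "level_prob \<pi> l = measure_pmf.prob \<pi> {s. fst s = l}"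

text \<open>\<open>z\<^sub>j\<close> computed with \<open>N\<^sub>i\<close> saturated, \<open>z\<^sub>j = \<pi>\<^sub>j(1) / (1 - \<pi>\<^sub>j(0))\<close>, with two conventions:
  if \<open>MC\<^sub>j\<close> has no stationary distribution, then \<open>N\<^sub>j\<close> is itself saturated, and \<open>z\<^sub>j = 0\<close> as for any
  saturated node; if \<open>\<pi>\<^sub>j(0) = 1\<close> (only for \<open>\<lambda>\<^sub>j = 0\<close>), the quotient is \<open>0/0\<close> and \<open>z\<^sub>j = 1\<close>, its
  limit for \<open>\<lambda>\<^sub>j \<rightarrow> 0\<close>.\<close>

definition z_sat :: "real \<Rightarrow> real \<Rightarrow> real \<Rightarrow> real \<Rightarrow> real" where
  "z_sat lam_i p_i lam_j p_j =
     (if \<exists>\<pi>. sat_stationary lam_i p_i lam_j p_j \<pi>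
      then let \<pi> = (THE \<pi>. sat_stationary lam_i p_i lam_j p_j \<pi>)
           in if level_prob \<pi> 0 = 1 then 1 else level_prob \<pi> 1 / (1 - level_prob \<pi> 0)
      else 0)"

definition alpha_sat :: "real \<Rightarrow> real \<Rightarrow> real \<Rightarrow> real \<Rightarrow> real^2" where
  "alpha_sat lam_i p_i lam_j p_j =
     (THE \<alpha>. stationary_vec (A_mat lam_i p_i lam_j p_j (z_sat lam_i p_i lam_j p_j)) \<alpha>)"

text \<open>\<open>\<lambda>\<^sub>i\<^sup>S\<^sup>R(\<lambda>\<^sub>j)\<close>. The argument \<open>\<lambda>\<^sub>i\<close> is only there because it occurs in the chains
  \<open>MC\<^sub>i\<close> and \<open>MC\<^sub>j\<close>.\<close>

definition lam_SR :: "real \<Rightarrow> real \<Rightarrow> real \<Rightarrow> real \<Rightarrow> real" where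
  "lam_SR lam_i p_i lam_j p_j =
     (\<Sum>h\<in>UNIV. alpha_sat lam_i p_i lam_j p_j $ h * p_suc p_i p_j h)"

definition SR_model :: "real \<Rightarrow> real \<Rightarrow> (real \<times> real) set" where
  "SR_model p1 p2 = {(lam1, lam2). lam1 \<in> {0..1} \<and> lam2 \<in> {0..1} \<and>
     lam1 < lam_SR lam1 p1 lam2 p2 \<and> lam2 < lam_SR lam2 p2 lam1 p1}"

text \<open>The network itself: successful transmissions (of \<open>N\<^sub>1\<close>, of \<open>N\<^sub>2\<close>) in a slot, and one slot of
  the chain of the two queue lengths.\<close>

definition departures :: "real \<Rightarrow> real \<Rightarrow> nat \<times> nat \<Rightarrow> (bool \<times> bool) pmf" where
  "departures p1 p2 = (\<lambda>(q1, q2).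
     do {
       t1 \<leftarrow> bernoulli_pmf (p1 * of_bool (q1 > 0));
       t2 \<leftarrow> bernoulli_pmf (p2 * of_bool (q2 > 0));
       return_pmf (t1 \<and> \<not> t2, t2 \<and> \<not> t1)
     })"

definition aloha_step ::
  "real \<Rightarrow> real \<Rightarrow> real \<Rightarrow> real \<Rightarrow> nat \<times> nat \<Rightarrow> (nat \<times> nat) pmf" where
  "aloha_step lam1 p1 lam2 p2 = (\<lambda>(q1, q2).
     do {
       (d1, d2) \<leftarrow> departures p1 p2 (q1, q2);
       a1 \<leftarrow> bernoulli_pmf lam1;
       a2 \<leftarrow> bernoulli_pmf lam2;
       return_pmf (q1 - of_bool d1 + of_bool a1, q2 - of_bool d2 + of_bool a2)
     })"

text \<open>Stability: the chain of queue lengths has a steady state (for \<open>0 < \<lambda>\<^sub>1, \<lambda>\<^sub>2 < 1\<close> it is irreducible,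
  so this is positive recurrence), in which the rate of successful transmissions of each node
  equals its arrival rate.\<close>

definition aloha_stable :: "real \<Rightarrow> real \<Rightarrow> real \<Rightarrow> real \<Rightarrow> bool" where
  "aloha_stable lam1 p1 lam2 p2 \<longleftrightarrow>
     (\<exists>\<pi>. bind_pmf \<pi> (aloha_step lam1 p1 lam2 p2) = \<pi> \<and>
          measure_pmf.prob (bind_pmf \<pi> (departures p1 p2)) {d. fst d} = lam1 \<and>
          measure_pmf.prob (bind_pmf \<pi> (departures p1 p2)) {d. snd d} = lam2)"

definition SR_exact :: "real \<Rightarrow> real \<Rightarrow> (real \<times> real) set" where
  "SR_exact p1 p2 =
     {(lam1, lam2). lam1 \<in> {0..1} \<and> lam2 \<in> {0..1} \<and> aloha_stable lam1 p1 lam2 p2}"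

lemma mc_step_shift:
  assumes "q > 0"
  shows "mc_step a b c d z (q + k, h) = map_pmf (apfst (\<lambda>l. l + k)) (mc_step a b c d z (q, h))"
  using assms
  by (auto simp: mc_step_def map_bind_pmf Let_def intro!: bind_pmf_cong)

lemma level_block_indep:
  assumes "l \<ge> 2"
  shows "level_block a b c d z l (l + 1) = A0 a b c d z"
    and "level_block a b c d z l l = A1 a b c d z"
    and "level_block a b c d z l (l - 1) = A2 a b c d z"
proof -
  obtain k where k: "l = 2 + k" using assms by (metis le_iff_add)
  have inj: "inj (apfst (\<lambda>l. l + k) :: nat \<times> phase \<Rightarrow> _)"
    by (auto simp: inj_def)
  have "pmf (mc_step a b c d z (2 + k, h)) (m + k, h') = pmf (mc_step a b c d z (2, h)) (m, h')"
    for m h h'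
  proof -
    have "mc_step a b c d z (2 + k, h) = map_pmf (apfst (\<lambda>l. l + k)) (mc_step a b c d z (2, h))"
      by (rule mc_step_shift) simp
    then show ?thesis
      using pmf_map_inj'[OF inj, of "mc_step a b c d z (2, h)" "(m, h')"] by simp
  qed
  from this[of _ 3] this[of _ 2] this[of _ 1]
  show "level_block a b c d z l (l + 1) = A0 a b c d z"
    and "level_block a b c d z l l = A1 a b c d z"
    and "level_block a b c d z l (l - 1) = A2 a b c d z"
    by (simp_all add: k level_block_def A0_def A1_def A2_def vec_eq_iff eval_nat_numeral)
qed

end

theory Submission
  imports Defs
begin

text \<open>Saturating \<open>N\<^sub>i\<close> turns \<open>MC\<^sub>j\<close> into a birth-death walk with up probability \<open>\<lambda>\<^sub>j\<close> and service
  probability \<open>p\<^sub>j (1 - p\<^sub>i)\<close>, whose two lowest levels give \<open>z\<^sub>j\<close> and hence \<open>\<alpha>(2) = \<lambda>\<^sub>j / (p\<^sub>j (1 - p\<^sub>i))\<close>, capped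
  at \<open>1\<close> in the unstable case.

  The chain of queue lengths has constant drift on the interior and on each axis of the quadrant.
  Inside the region a quadratic Lyapunov function has drift at most \<open>-1\<close> off a finite set; vague
  limits of the Cesaro averages are then nonzero, and invariant because only finitely many states
  lead to a given one. A function with bounded increments has mean drift zero under a stationary
  distribution, so rates balance automatically, and there is no stationary distribution if some such
  function has nonnegative drift that is positive at a state of positive mass. If only one queue is
  overloaded, such a function is a linear one, bent so as to compensate for the wrong sign of its
  drift on one axis. If both are overloaded, which includes the case of zero drift in the interior, a
  quadratic function continued linearly at infinity plays that part.\<close>

section \<open>Stationary distributions of Markov chains\<close>

definition drift :: "('a \<Rightarrow> 'a pmf) \<Rightarrow> ('a \<Rightarrow> real) \<Rightarrow> 'a \<Rightarrow> real" where
  "drift K g x = measure_pmf.expectation (K x) g - g x"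

lemma expectation_mono:
  fixes f g :: "'a \<Rightarrow> real"
  assumes "finite (set_pmf p)" "\<And>y. y \<in> set_pmf p \<Longrightarrow> f y \<le> g y"
  shows "measure_pmf.expectation p f \<le> measure_pmf.expectation p g"
  by (intro integral_mono_AE integrable_measure_pmf_finite assms(1)) (use assms(2) in \<open>simp add: AE_measure_pmf_iff\<close>)

lemma abs_expectation_le:
  fixes g :: "'a \<Rightarrow> real"
  assumes "finite (set_pmf p)" "\<And>y. y \<in> set_pmf p \<Longrightarrow> \<bar>g y\<bar> \<le> B"
  shows "\<bar>measure_pmf.expectation p g\<bar> \<le> B"
proof -
  have "- B \<le> g y" "g y \<le> B" if "y \<in> set_pmf p" for y
    using assms(2)[OF that] by linarith+
  then have "measure_pmf.expectation p (\<lambda>_. - B) \<le> measure_pmf.expectation p g"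
    "measure_pmf.expectation p g \<le> measure_pmf.expectation p (\<lambda>_. B)"
    by (intro expectation_mono assms(1); blast)+
  then show ?thesis by simp
qed

lemma expectation_bind_finite:
  fixes h :: "'b \<Rightarrow> real"
  assumes "finite (set_pmf p)" "\<And>x. x \<in> set_pmf p \<Longrightarrow> finite (set_pmf (f x))"
  shows "measure_pmf.expectation (bind_pmf p f) h =
    measure_pmf.expectation p (\<lambda>x. measure_pmf.expectation (f x) h)"
  using pmf_expectation_bind[of "set_pmf p" f p h] assms
  by (simp add: integral_measure_pmf[of "set_pmf p"])

text \<open>A stationary distribution may have infinite support, out of reach of the finite version;
  boundedness of \<open>g\<close> takes the place of finiteness.\<close>

lemma expectation_bind_bounded:
  fixes g :: "'b \<Rightarrow> real"
  assumes "\<And>y. \<bar>g y\<bar> \<le> B"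
  shows "measure_pmf.expectation (bind_pmf p f) g = measure_pmf.expectation p (\<lambda>x. measure_pmf.expectation (f x) g)"
  unfolding measure_pmf_bind
  by (rule integral_bind[where K="count_space UNIV" and B'=1 and B=B])
     (use assms measurable_measure_pmf[of f] in \<open>auto simp: space_subprob_algebra measure_pmf.emeasure_space_1 intro!: measure_pmf.emeasure_le_1\<close>)

text \<open>No moment of \<open>g\<close> is assumed: clamping \<open>g\<close> to \<open>[-n, n]\<close> keeps its increments bounded
  and makes it integrable, and \<open>n \<rightarrow> \<infinity>\<close> by dominated convergence.\<close>

lemma stationary_drift_zero:
  fixes g :: "'a \<Rightarrow> real"
  assumes stat: "bind_pmf \<pi> K = \<pi>"
    and fin: "\<And>x. finite (set_pmf (K x))"
    and inc: "\<And>x y. y \<in> set_pmf (K x) \<Longrightarrow> \<bar>g y - g x\<bar> \<le> B"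
  shows "integrable \<pi> (drift K g)" "measure_pmf.expectation \<pi> (drift K g) = 0"
proof -
  define c where "c = (\<lambda>n x. max (- real n) (min (real n) (g x)))"
  have c_bd: "\<bar>c n x\<bar> \<le> real n" for n x by (auto simp: c_def)
  have B0: "0 \<le> B"
  proof -
    obtain x y where "y \<in> set_pmf (K x)" using set_pmf_not_empty by fastforce
    then show ?thesis using inc[of y x] by linarith
  qed
  have drift_c: "drift K (c n) x = measure_pmf.expectation (K x) (\<lambda>y. c n y - c n x)" for n x
    unfolding drift_def by (subst Bochner_Integration.integral_diff) (auto intro!: integrable_measure_pmf_finite fin)
  have dbd: "\<bar>drift K (c n) x\<bar> \<le> B" for n x
  proof -
    have "\<bar>c n y - c n x\<bar> \<le> B" if "y \<in> set_pmf (K x)" for y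
      using inc[OF that] by (auto simp: c_def)
    then show ?thesis unfolding drift_c by (intro abs_expectation_le fin)
  qed
  have lim: "(\<lambda>n. drift K (c n) x) \<longlonglongrightarrow> drift K g x" for x
  proof -
    \<comment> \<open>For such \<open>n\<close> the clamp acts neither at \<open>x\<close> nor at
      any successor of \<open>x\<close>.\<close>
    have "drift K (c n) x = drift K g x" if n: "real n \<ge> \<bar>g x\<bar> + B" for n
    proof -
      have eq: "c n y = g y" if "y = x \<or> y \<in> set_pmf (K x)" for y
        using that inc[of y x] n B0 by (auto simp: c_def)
      have "measure_pmf.expectation (K x) (c n) = measure_pmf.expectation (K x) g"
        by (intro integral_cong_AE) (simp_all add: AE_measure_pmf_iff eq)
      then show ?thesis by (simp add: drift_def eq)
    qed
    moreover have "eventually (\<lambda>n. real n \<ge> \<bar>g x\<bar> + B) sequentially"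
      using eventually_ge_at_top[of "nat \<lceil>\<bar>g x\<bar> + B\<rceil>"] by eventually_elim linarith
    ultimately show ?thesis by (intro tendsto_eventually) (auto elim: eventually_mono)
  qed
  have z: "measure_pmf.expectation \<pi> (drift K (c n)) = 0" for n
  proof -
    have "\<bar>measure_pmf.expectation (K x) (c n)\<bar> \<le> real n" for x
      by (intro abs_expectation_le fin c_bd)
    then have "integrable \<pi> (\<lambda>x. measure_pmf.expectation (K x) (c n))" "integrable \<pi> (c n)"
      using c_bd by (auto intro!: measure_pmf.integrable_const_bound[where B="real n"])
    then show ?thesis
      using expectation_bind_bounded[OF c_bd, of \<pi> K n] stat
      unfolding drift_def by (subst Bochner_Integration.integral_diff) simp_all
  qed
  have "integrable \<pi> (drift K g) \<and> (\<lambda>n. measure_pmf.expectation \<pi> (drift K (c n))) \<longlonglongrightarrow> measure_pmf.expectation \<pi> (drift K g)"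
    using integrable_dominated_convergence[of "drift K g" \<pi> "\<lambda>n. drift K (c n)" "\<lambda>_. B"]
      integral_dominated_convergence[of "drift K g" \<pi> "\<lambda>n. drift K (c n)" "\<lambda>_. B"] lim dbd by simp
  then show "integrable \<pi> (drift K g)" "measure_pmf.expectation \<pi> (drift K g) = 0"
    by (auto simp: z LIMSEQ_const_iff)
qed

text \<open>Tychonoff makes the product of the intervals compact; over a countable index set it is
  first countable, hence sequentially compact. This replaces a diagonal argument.\<close>

lemma pointwise_convergent_subseq:
  fixes f :: "nat \<Rightarrow> 'a::countable \<Rightarrow> real"
  assumes "\<And>n x. f n x \<in> {a..b}"
  obtains l r where "strict_mono (r :: nat \<Rightarrow> nat)" "\<And>x. (\<lambda>n. f (r n) x) \<longlonglongrightarrow> l x"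
proof -
  have "compactin (product_topology (\<lambda>_::'a. euclideanreal) UNIV) (\<Pi>\<^sub>E x\<in>UNIV. {a..b})"
    by (subst compactin_PiE) auto
  then have "compact (\<Pi>\<^sub>E x\<in>(UNIV::'a set). {a..b})"
    by (simp add: euclidean_product_topology)
  then have "seq_compact (\<Pi>\<^sub>E x\<in>(UNIV::'a set). {a..b})"
    by (rule compact_imp_seq_compact)
  moreover have "\<forall>n. f n \<in> (\<Pi>\<^sub>E x\<in>UNIV. {a..b})" using assms by auto
  ultimately obtain l r where "strict_mono (r :: nat \<Rightarrow> nat)" "(f \<circ> r) \<longlonglongrightarrow> l"
    unfolding seq_compact_def by meson
  moreover have "isCont (\<lambda>g :: 'a \<Rightarrow> real. g x) l" for x
    by (rule continuous_on_interior[OF continuous_on_product_coordinates]) simp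
  ultimately have "(\<lambda>n. (f \<circ> r) n x) \<longlonglongrightarrow> l x" for x
    by (intro isCont_tendsto_compose[of l "\<lambda>g. g x" "f \<circ> r"])
  with \<open>strict_mono r\<close> show ?thesis using that[of r l] by (simp add: comp_def)
qed

text \<open>With finitely many predecessors the balance equation at \<open>y\<close> is a finite
  sum, so it survives pointwise limits.\<close>

lemma pmf_bind_finite_pred:
  assumes "finite {x. y \<in> set_pmf (K x)}"
  shows "pmf (bind_pmf p K) y = (\<Sum>x | y \<in> set_pmf (K x). pmf (K x) y * pmf p x)"
  unfolding pmf_bind
  by (rule integral_measure_pmf_real[OF assms]) (auto simp: set_pmf_eq)

text \<open>Cesaro averages of the laws started at a point are asymptotically invariant. A pointwise
  limit could lose all mass at infinity; the drift condition keeps a fixed share of it on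
  \<open>F\<close>.\<close>

theorem foster_stationary:
  fixes K :: "'a::countable \<Rightarrow> 'a pmf" and V :: "'a \<Rightarrow> real"
  assumes succ: "\<And>x. finite (set_pmf (K x))"
    and pred: "\<And>y. finite {x. y \<in> set_pmf (K x)}"
    and V0: "\<And>x. 0 \<le> V x"
    and F: "finite F" and eps: "0 < \<epsilon>"
    and drift: "\<And>x. x \<notin> F \<Longrightarrow> drift K V x \<le> - \<epsilon>"
  shows "\<exists>\<pi>. bind_pmf \<pi> K = \<pi>"
proof -
  define x0 :: 'a where "x0 = undefined"
  define \<mu> where "\<mu> n = ((\<lambda>p. bind_pmf p K) ^^ n) (return_pmf x0)" for n
  have mu0: "\<mu> 0 = return_pmf x0" and muS: "\<mu> (Suc n) = bind_pmf (\<mu> n) K" for n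
    by (simp_all add: \<mu>_def)
  have fin: "finite (set_pmf (\<mu> n))" for n
    by (induction n) (auto simp: mu0 muS succ)
  define b where "b = Max (insert 0 (drift K V ` F))"
  have b0: "0 \<le> b" and bF: "\<And>x. x \<in> F \<Longrightarrow> drift K V x \<le> b"
    using F by (auto simp: b_def)
  \<comment> \<open>A step lowers the mean of \<open>V\<close> by \<open>\<epsilon>\<close>, up to a
    correction of at most \<open>b + \<epsilon>\<close> for each visit to \<open>F\<close>.\<close>
  have EV: "measure_pmf.expectation (\<mu> n) V
      \<le> V x0 - real n * \<epsilon> + (b + \<epsilon>) * (\<Sum>k<n. measure_pmf.prob (\<mu> k) F)" for n
  proof (induction n)
    case (Suc n)
    have "measure_pmf.expectation (K x) V \<le> V x + (- \<epsilon> + (b + \<epsilon>) * indicator F x)" for x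
      using drift[of x] bF[of x] b0 eps by (auto simp: drift_def split: split_indicator)
    then have "measure_pmf.expectation (\<mu> (Suc n)) V
        \<le> measure_pmf.expectation (\<mu> n) (\<lambda>x. V x + (- \<epsilon> + (b + \<epsilon>) * indicator F x))"
      unfolding muS by (subst expectation_bind_finite) (auto intro!: expectation_mono fin succ)
    also have "\<dots> = measure_pmf.expectation (\<mu> n) V - \<epsilon> + (b + \<epsilon>) * measure_pmf.prob (\<mu> n) F"
      by (simp add: integrable_measure_pmf_finite fin)
    finally show ?case using Suc.IH by (simp add: algebra_simps)
  qed (simp add: mu0)
  define \<nu> where "\<nu> n y = (\<Sum>k<n. pmf (\<mu> k) y) / real n" for n y
  have "\<nu> n y \<in> {0..1}" for n y
  proof -
    have "(\<Sum>k<n. pmf (\<mu> k) y) \<le> (\<Sum>k<n. 1)" by (intro sum_mono pmf_le_1)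
    then show ?thesis by (auto simp: \<nu>_def sum_nonneg divide_le_eq_1)
  qed
  then obtain l r where r: "strict_mono (r :: nat \<Rightarrow> nat)" and lim: "\<And>y. (\<lambda>n. \<nu> (r n) y) \<longlonglongrightarrow> l y"
    using pointwise_convergent_subseq[of \<nu> 0 1] by blast
  have small: "(\<lambda>n. c n / real (r n)) \<longlonglongrightarrow> 0" if "\<And>n. \<bar>c n\<bar> \<le> B" for c B
  proof (rule Lim_null_comparison)
    show "(\<lambda>n. B * inverse (real (r n))) \<longlonglongrightarrow> 0"
      using LIMSEQ_subseq_LIMSEQ[OF lim_inverse_n r]
      by (intro tendsto_mult_right_zero) (simp add: comp_def)
    show "\<forall>\<^sub>F n in sequentially. norm (c n / real (r n)) \<le> B * inverse (real (r n))"
      using that by (intro always_eventually allI) (auto simp: divide_simps)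
  qed
  have l0: "0 \<le> l y" for y
    using lim by (rule LIMSEQ_le_const) (auto simp: \<nu>_def sum_nonneg)
  have inv: "(\<Sum>x | y \<in> set_pmf (K x). pmf (K x) y * l x) = l y" for y
  proof (rule LIMSEQ_unique)
    show "(\<lambda>n. \<Sum>x | y \<in> set_pmf (K x). pmf (K x) y * \<nu> (r n) x)
        \<longlonglongrightarrow> (\<Sum>x | y \<in> set_pmf (K x). pmf (K x) y * l x)"
      by (intro tendsto_intros lim)
    \<comment> \<open>Applying the kernel shifts the summation index, so the sums differ by two end
      terms only, which vanish after division by \<open>n\<close>.\<close>
    have "(\<Sum>x | y \<in> set_pmf (K x). pmf (K x) y * \<nu> n x)
        = \<nu> n y + (pmf (\<mu> n) y - pmf (\<mu> 0) y) / real n" for n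
    proof -
      have "(\<Sum>x | y \<in> set_pmf (K x). pmf (K x) y * \<nu> n x) = (\<Sum>k<n. pmf (\<mu> (Suc k)) y) / real n"
        unfolding \<nu>_def muS pmf_bind_finite_pred[OF pred]
        by (subst sum.swap) (simp add: sum_distrib_left sum_divide_distrib)
      also have "(\<Sum>k<n. pmf (\<mu> (Suc k)) y) = (\<Sum>k<n. pmf (\<mu> k) y) + (pmf (\<mu> n) y - pmf (\<mu> 0) y)"
        by (induction n) auto
      finally show ?thesis by (simp add: \<nu>_def add_divide_distrib)
    qed
    moreover have "(\<lambda>n. \<nu> (r n) y + (pmf (\<mu> (r n)) y - pmf (\<mu> 0) y) / real (r n)) \<longlonglongrightarrow> l y + 0"
    proof (intro tendsto_add lim small)
      show "\<bar>pmf (\<mu> (r n)) y - pmf (\<mu> 0) y\<bar> \<le> 1" for n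
        using pmf_le_1[of "\<mu> (r n)" y] pmf_le_1[of "\<mu> 0" y] pmf_nonneg[of "\<mu> (r n)" y] pmf_nonneg[of "\<mu> 0" y]
        by linarith
    qed
    ultimately show "(\<lambda>n. \<Sum>x | y \<in> set_pmf (K x). pmf (K x) y * \<nu> (r n) x) \<longlonglongrightarrow> l y" by simp
  qed
  \<comment> \<open>Nonnegativity of \<open>V\<close> turns the accumulated drift bound into a lower
    bound for the time spent in \<open>F\<close>.\<close>
  have "\<epsilon> / (b + \<epsilon>) \<le> (\<Sum>x\<in>F. l x)"
  proof (rule LIMSEQ_le)
    show "(\<lambda>n. \<Sum>x\<in>F. \<nu> (r n) x) \<longlonglongrightarrow> (\<Sum>x\<in>F. l x)" by (intro tendsto_intros lim)
    have "(\<lambda>n. \<epsilon> / (b + \<epsilon>) - (V x0 / (b + \<epsilon>)) / real (r n)) \<longlonglongrightarrow> \<epsilon> / (b + \<epsilon>) - 0"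
      by (intro tendsto_diff tendsto_const small) (rule order_refl)
    then show "(\<lambda>n. \<epsilon> / (b + \<epsilon>) - (V x0 / (b + \<epsilon>)) / real (r n)) \<longlonglongrightarrow> \<epsilon> / (b + \<epsilon>)" by simp
    have "\<epsilon> / (b + \<epsilon>) - (V x0 / (b + \<epsilon>)) / real n \<le> (\<Sum>x\<in>F. \<nu> n x)" if n: "n \<ge> 1" for n
    proof -
      have "0 \<le> measure_pmf.expectation (\<mu> n) V" by (intro integral_nonneg_AE AE_I2 V0)
      then have "real n * \<epsilon> - V x0 \<le> (b + \<epsilon>) * (\<Sum>k<n. measure_pmf.prob (\<mu> k) F)"
        using EV[of n] by linarith
      also have "(\<Sum>k<n. measure_pmf.prob (\<mu> k) F) = real n * (\<Sum>x\<in>F. \<nu> n x)"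
        using n unfolding \<nu>_def measure_measure_pmf_finite[OF F] sum_divide_distrib[symmetric]
        by (subst sum.swap) simp
      finally have "(real n * \<epsilon> - V x0) / ((b + \<epsilon>) * real n) \<le> (\<Sum>x\<in>F. \<nu> n x)"
        using n eps b0 by (subst pos_divide_le_eq) (simp_all add: mult_ac)
      moreover have "\<epsilon> / (b + \<epsilon>) - (V x0 / (b + \<epsilon>)) / real n = (real n * \<epsilon> - V x0) / ((b + \<epsilon>) * real n)"
        using n eps b0 by (simp add: diff_divide_distrib)
      ultimately show ?thesis by simp
    qed
    moreover have "r n \<ge> 1" if "n \<ge> 1" for n using seq_suble[OF r, of n] that by linarith
    ultimately show "\<exists>N. \<forall>n\<ge>N. \<epsilon> / (b + \<epsilon>) - (V x0 / (b + \<epsilon>)) / real (r n) \<le> (\<Sum>x\<in>F. \<nu> (r n) x)"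
      by (intro exI[of _ 1]) simp
  qed
  moreover have "0 < \<epsilon> / (b + \<epsilon>)" using eps b0 by simp
  ultimately have "(\<Sum>x\<in>F. l x) \<noteq> 0" by linarith
  then obtain x1 where "l x1 \<noteq> 0" by (meson sum.neutral)
  then have x1: "0 < l x1" using l0[of x1] by simp
  \<comment> \<open>By Fatou the limit has mass at most 1; some may have escaped, hence the
    normalisation by \<open>s\<close> below.\<close>
  define S where "S = (\<integral>\<^sup>+ x. ennreal (l x) \<partial>count_space UNIV)"
  have "S \<le> liminf (\<lambda>n. \<integral>\<^sup>+ x. ennreal (\<nu> (r n) x) \<partial>count_space UNIV)"
  proof -
    have "ennreal (l x) = liminf (\<lambda>n. ennreal (\<nu> (r n) x))" for x
      using lim_imp_Liminf[OF _ tendsto_ennrealI[OF lim[of x]]] by simp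
    then show ?thesis unfolding S_def by (simp add: nn_integral_liminf)
  qed
  also have "\<dots> \<le> liminf (\<lambda>n. 1 :: ennreal)"
  proof (intro Liminf_mono always_eventually allI)
    fix n
    have "(\<integral>\<^sup>+ x. ennreal (\<nu> m x) \<partial>count_space UNIV) \<le> 1" for m
    proof (cases "m = 0")
      case False
      have "(\<integral>\<^sup>+ x. ennreal (\<nu> m x) \<partial>count_space UNIV)
          = (\<integral>\<^sup>+ x. (\<Sum>k<m. ennreal (pmf (\<mu> k) x)) / ennreal (real m) \<partial>count_space UNIV)"
        using False by (intro nn_integral_cong) (simp add: \<nu>_def divide_ennreal sum_nonneg)
      also have "\<dots> = (\<Sum>k<m. \<integral>\<^sup>+ x. ennreal (pmf (\<mu> k) x) \<partial>count_space UNIV) / ennreal (real m)"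
        by (simp add: nn_integral_divide nn_integral_sum del: sum_ennreal)
      also have "\<dots> = 1"
        using False by (simp add: nn_integral_pmf ennreal_of_nat_eq_real_of_nat)
      finally show ?thesis by simp
    qed (simp add: \<nu>_def)
    then show "(\<integral>\<^sup>+ x. ennreal (\<nu> (r n) x) \<partial>count_space UNIV) \<le> 1" .
  qed
  finally have S1: "S \<le> 1" by (simp add: Liminf_const)
  have "ennreal (l x1) \<le> S" unfolding S_def by (rule nn_integral_ge_point) simp
  then obtain s where s: "S = ennreal s" "0 < s"
    using S1 x1
  proof (cases S)
    case (real t)
    then show ?thesis using that[of t] \<open>ennreal (l x1) \<le> S\<close> x1 by (simp add: ennreal_le_iff)
  qed (use S1 in \<open>simp add: top_unique\<close>)
  define \<pi> where "\<pi> = embed_pmf (\<lambda>x. l x / s)"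
  have pmf_pi: "pmf \<pi> x = l x / s" for x
    unfolding \<pi>_def
  proof (rule pmf_embed_pmf)
    show "0 \<le> l x / s" for x using l0 s by simp
    have "(\<integral>\<^sup>+ x. ennreal (l x / s) \<partial>count_space UNIV) = (\<integral>\<^sup>+ x. ennreal (l x) / ennreal s \<partial>count_space UNIV)"
      using l0 s by (simp add: divide_ennreal)
    also have "\<dots> = S / ennreal s" by (simp add: nn_integral_divide S_def)
    finally show "(\<integral>\<^sup>+ x. ennreal (l x / s) \<partial>count_space UNIV) = 1" using s by (simp add: divide_ennreal)
  qed
  have "bind_pmf \<pi> K = \<pi>"
    by (rule pmf_eqI) (simp add: pmf_bind_finite_pred[OF pred] pmf_pi inv flip: sum_divide_distrib)
  then show ?thesis ..
qed

section \<open>The saturated model\<close>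

definition bernoulli_walk :: "real \<Rightarrow> real \<Rightarrow> nat \<Rightarrow> nat pmf" where
  "bernoulli_walk lam s = (\<lambda>q.
     do {
       d \<leftarrow> bernoulli_pmf (s * of_bool (q > 0));
       a \<leftarrow> bernoulli_pmf lam;
       return_pmf (q - of_bool d + of_bool a)
     })"

lemma expectation_bernoulli_bind:
  fixes f :: "'a \<Rightarrow> real"
  assumes "0 \<le> p" "p \<le> 1" "\<And>b. finite (set_pmf (k b))"
  shows "measure_pmf.expectation (bind_pmf (bernoulli_pmf p) k) f =
    p * measure_pmf.expectation (k True) f + (1 - p) * measure_pmf.expectation (k False) f"
  using assms by (subst expectation_bind_finite) auto

lemma finite_set_bernoulli_walk [simp]: "finite (set_pmf (bernoulli_walk lam s q))"
  by (simp add: bernoulli_walk_def)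

lemma set_bernoulli_walk: "y \<in> set_pmf (bernoulli_walk lam s x) \<Longrightarrow> x \<le> Suc y \<and> y \<le> Suc x"
  by (auto simp: bernoulli_walk_def)

lemma pmf_bernoulli_walk:
  assumes "0 \<le> lam" "lam \<le> 1" "0 \<le> s" "s \<le> 1"
  shows "pmf (bernoulli_walk lam s 0) y = (if y = 0 then 1 - lam else if y = 1 then lam else 0)"
    and "pmf (bernoulli_walk lam s (Suc n)) y = (if y = n then s * (1 - lam)
      else if y = Suc n then s * lam + (1 - s) * (1 - lam)
      else if y = Suc (Suc n) then (1 - s) * lam else 0)"
  using assms by (auto simp: bernoulli_walk_def pmf_bind pmf_return algebra_simps)

lemma drift_bernoulli_walk:
  assumes "0 \<le> lam" "lam \<le> 1" "0 \<le> s" "s \<le> 1"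
  shows "drift (bernoulli_walk lam s) real q = lam - s * of_bool (q > 0)"
proof (cases q)
  case 0
  then show ?thesis
    using assms by (simp add: drift_def bernoulli_walk_def expectation_bernoulli_bind)
next
  case (Suc n)
  then show ?thesis
    using assms by (simp add: drift_def bernoulli_walk_def expectation_bernoulli_bind algebra_simps)
qed

text \<open>The first two equations balance the flow across the cut between neighbouring levels and
  follow upwards from level 0. The third is the vanishing mean drift of the queue length.\<close>

lemma stationary_bernoulli_walk:
  assumes par: "0 \<le> lam" "lam \<le> 1" "0 \<le> s" "s \<le> 1"
    and stat: "bind_pmf \<rho> (bernoulli_walk lam s) = \<rho>"
  shows "pmf \<rho> 1 * (s * (1 - lam)) = lam * pmf \<rho> 0"
    and "pmf \<rho> (Suc (Suc n)) * (s * (1 - lam)) = (1 - s) * lam * pmf \<rho> (Suc n)"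
    and "s * (1 - pmf \<rho> 0) = lam"
proof -
  \<comment> \<open>For \<open>y = 0\<close> the truncated \<open>y - 1\<close> is \<open>0\<close>,
    and the set has only two elements.\<close>
  have sum: "pmf \<rho> y = (\<Sum>x\<in>{y - 1, y, y + 1}. pmf (bernoulli_walk lam s x) y * pmf \<rho> x)" for y
  proof -
    have "pmf \<rho> y = pmf (bind_pmf \<rho> (bernoulli_walk lam s)) y" using stat by simp
    also have "\<dots> = (\<Sum>x\<in>{y - 1, y, y + 1}. pmf (bernoulli_walk lam s x) y * pmf \<rho> x)"
      unfolding pmf_bind
    proof (rule integral_measure_pmf_real)
      fix x assume "pmf (bernoulli_walk lam s x) y \<noteq> 0"
      then have "y \<in> set_pmf (bernoulli_walk lam s x)" by (simp add: set_pmf_iff)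
      from set_bernoulli_walk[OF this] show "x \<in> {y - 1, y, y + 1}" by auto
    qed simp
    finally show ?thesis .
  qed
  show 1: "pmf \<rho> 1 * (s * (1 - lam)) = lam * pmf \<rho> 0"
    using sum[of 0] pmf_bernoulli_walk[OF par] by (simp add: algebra_simps)
  have "pmf \<rho> (Suc (Suc n)) * (s * (1 - lam)) = (1 - s) * lam * pmf \<rho> (Suc n)" for n
  proof (induction n)
    case 0
    show ?case
      using sum[of 1] 1 pmf_bernoulli_walk[OF par] by (simp add: algebra_simps eval_nat_numeral)
  next
    case (Suc n)
    show ?case
      using sum[of "Suc (Suc n)"] Suc pmf_bernoulli_walk[OF par] by (simp add: algebra_simps)
  qed
  then show "pmf \<rho> (Suc (Suc n)) * (s * (1 - lam)) = (1 - s) * lam * pmf \<rho> (Suc n)" .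
  have "measure_pmf.expectation \<rho> (drift (bernoulli_walk lam s) real) = 0"
    by (rule stationary_drift_zero(2)[OF stat, where B=1]) (auto dest!: set_bernoulli_walk)
  moreover have "drift (bernoulli_walk lam s) real = (\<lambda>q. lam - s + s * indicator {0} q)"
    by (auto simp: drift_bernoulli_walk[OF par] fun_eq_iff split: split_indicator)
  moreover have "measure_pmf.expectation \<rho> (\<lambda>q. lam - s + s * indicator {0} q) = lam - s + s * pmf \<rho> 0"
    by (subst Bochner_Integration.integral_add)
       (auto simp: measure_pmf_single measure_pmf.emeasure_eq_measure)
  ultimately have "lam - s + s * pmf \<rho> 0 = 0" by simp
  then show "s * (1 - pmf \<rho> 0) = lam" by (simp add: algebra_simps)
qed

text \<open>The rate equation fixes the mass at 0; the cut equations then fix each level from the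
  one below, as \<open>s * (1 - lam)\<close> is nonzero.\<close>

lemma bernoulli_walk_unique:
  assumes par: "0 \<le> lam" "lam < 1" "0 < s" "s \<le> 1"
    and stat: "bind_pmf \<rho> (bernoulli_walk lam s) = \<rho>" "bind_pmf \<rho>' (bernoulli_walk lam s) = \<rho>'"
  shows "\<rho> = \<rho>'"
proof (rule pmf_eqI)
  fix n
  note st = stationary_bernoulli_walk[OF _ _ _ _ stat(1)] stationary_bernoulli_walk[OF _ _ _ _ stat(2)]
  have pos: "s * (1 - lam) \<noteq> 0" using par by simp
  have 0: "pmf \<rho> 0 = pmf \<rho>' 0" using st(3,6) par by (metis diff_left_imp_eq less_eq_real_def mult_left_cancel less_irrefl)
  have 1: "pmf \<rho> (Suc n) = pmf \<rho>' (Suc n)" for n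
  proof (induction n)
    case 0
    show ?case using st(1,4) par pos \<open>pmf \<rho> 0 = pmf \<rho>' 0\<close> by (metis One_nat_def less_eq_real_def mult_right_cancel)
  next
    case (Suc n)
    show ?case using st(2,5)[of n] par pos Suc by (metis less_eq_real_def mult_right_cancel)
  qed
  show "pmf \<rho> n = pmf \<rho>' n" using 0 1 by (cases n) auto
qed

lemma bernoulli_walk_exists:
  assumes "0 \<le> lam" "lam < s" "s \<le> 1"
  shows "\<exists>\<rho>. bind_pmf \<rho> (bernoulli_walk lam s) = \<rho>"
proof (rule foster_stationary[where V=real and F="{0}" and \<epsilon>="s - lam"])
  show "finite {x. y \<in> set_pmf (bernoulli_walk lam s x)}" for y
    by (rule finite_subset[of _ "{..Suc y}"]) (auto dest: set_bernoulli_walk)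
qed (use assms in \<open>auto simp: drift_bernoulli_walk\<close>)

text \<open>The rate equation forces \<open>lam = s\<close> and no mass at 0, and the cut equations
  carry this zero to all levels. For \<open>s = lam = 1\<close> positive levels would be absorbing,
  hence \<open>s < 1\<close>.\<close>

lemma bernoulli_walk_not_exists:
  assumes "0 < s" "s < 1" "s \<le> lam" "lam \<le> 1"
  shows "bind_pmf \<rho> (bernoulli_walk lam s) \<noteq> \<rho>"
proof
  assume stat: "bind_pmf \<rho> (bernoulli_walk lam s) = \<rho>"
  note st = stationary_bernoulli_walk[OF _ _ _ _ stat]
  have "s * (1 - pmf \<rho> 0) = lam" using st(3) assms by simp
  moreover have "s * (1 - pmf \<rho> 0) \<le> s" using assms by (simp add: pmf_nonneg)
  ultimately have "lam = s" "pmf \<rho> 0 = 0" using assms by auto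
  have "pmf \<rho> (Suc n) = 0" for n
    by (induction n) (use st(1) st(2) assms \<open>lam = s\<close> \<open>pmf \<rho> 0 = 0\<close> in auto)
  with \<open>pmf \<rho> 0 = 0\<close> have "pmf \<rho> n = 0" for n by (cases n) auto
  then have "set_pmf \<rho> = {}" by (auto simp: set_pmf_eq)
  then show False by (simp add: set_pmf_not_empty)
qed

section \<open>The saturated phase chain and the border of instability\<close>

lemma bernoulli_and_not:
  assumes "0 \<le> a" "a \<le> 1" "0 \<le> b" "b \<le> 1"
  shows "bernoulli_pmf a \<bind> (\<lambda>x. bernoulli_pmf b \<bind> (\<lambda>y. k (x \<and> \<not> y))) =
    bernoulli_pmf (a * (1 - b)) \<bind> k"
proof -
  have "0 \<le> a * (1 - b)" "a * (1 - b) \<le> 1" using assms by (auto intro: mult_le_one)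
  then show ?thesis
    using assms by (intro pmf_eqI) (simp add: pmf_bind algebra_simps)
qed

lemma mc_step_saturated:
  assumes "0 \<le> p_j" "p_j \<le> 1" "0 \<le> p_i" "p_i \<le> 1"
  shows "mc_step lam_j p_j lam_i p_i 0 (q, 2) =
    map_pmf (\<lambda>q. (q, 2)) (bernoulli_walk lam_j (p_j * (1 - p_i)) q)"
proof -
  have bernoulli_0: "bernoulli_pmf 0 = return_pmf False"
    by (intro pmf_eqI) (auto simp: pmf_return split: split_indicator)
  have phase_2: "p_i * of_bool ((2::phase) = 2) = p_i" by simp
  have "mc_step lam_j p_j lam_i p_i 0 (q, 2) =
    bernoulli_pmf (p_j * of_bool (q > 0)) \<bind> (\<lambda>x. bernoulli_pmf p_i \<bind> (\<lambda>y. bernoulli_pmf lam_j \<bind>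
      (\<lambda>a. return_pmf (q - of_bool (x \<and> \<not> y) + of_bool a, 2))))"
    unfolding mc_step_def prod.case phase_2 bernoulli_0
    by (rule bind_pmf_cong[OF refl])+ (auto simp: bind_return_pmf intro!: bind_pmf_cong)
  also have "\<dots> = bernoulli_pmf (p_j * of_bool (q > 0) * (1 - p_i)) \<bind> (\<lambda>d. bernoulli_pmf lam_j \<bind>
      (\<lambda>a. return_pmf (q - of_bool d + of_bool a, 2)))"
    using assms by (intro bernoulli_and_not) auto
  finally show ?thesis
    by (simp add: bernoulli_walk_def map_bind_pmf map_pmf_comp mult_ac)
qed

text \<open>Without mass in phase 1, \<open>\<pi>\<close> is the image of its level distribution
  under an injection into phase 2, which cannot be left for \<open>z = 0\<close>; so invariance
  transfers both ways.\<close>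

lemma sat_stationary_iff:
  assumes "0 \<le> p_j" "p_j \<le> 1" "0 \<le> p_i" "p_i \<le> 1"
  shows "sat_stationary lam_i p_i lam_j p_j \<pi> \<longleftrightarrow>
    (\<exists>\<rho>. \<pi> = map_pmf (\<lambda>q. (q, 2)) \<rho> \<and> bind_pmf \<rho> (bernoulli_walk lam_j (p_j * (1 - p_i))) = \<rho>)"
    (is "_ \<longleftrightarrow> (\<exists>\<rho>. _ \<and> bind_pmf \<rho> ?W = \<rho>)")
proof -
  have inj: "inj (\<lambda>q::nat. (q, 2::phase))" by (auto simp: inj_def)
  have bind: "bind_pmf (map_pmf (\<lambda>q. (q, 2)) \<rho>) (mc_step lam_j p_j lam_i p_i 0) =
      map_pmf (\<lambda>q. (q, 2)) (bind_pmf \<rho> ?W)" for \<rho>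
    by (simp add: bind_map_pmf map_bind_pmf mc_step_saturated[OF assms])
  have phase: "(\<forall>l. pmf \<pi> (l, 1) = 0) \<longleftrightarrow> (\<exists>\<rho>. \<pi> = map_pmf (\<lambda>q. (q, 2)) \<rho>)"
  proof
    assume l: "\<forall>l. pmf \<pi> (l, 1) = 0"
    have "map_pmf (\<lambda>q. (q, 2)) (map_pmf fst \<pi>) = map_pmf id \<pi>"
      unfolding map_pmf_comp
    proof (intro map_pmf_cong refl)
      fix x assume "x \<in> set_pmf \<pi>"
      then have "snd x \<noteq> 1" using l by (metis prod.collapse pmf_eq_0_set_pmf)
      then show "(fst x, 2) = id x" using exhaust_2[of "snd x"] by (cases x) auto
    qed
    then show "\<exists>\<rho>. \<pi> = map_pmf (\<lambda>q. (q, 2)) \<rho>" by (metis map_pmf_id id_apply)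
  next
    assume "\<exists>\<rho>. \<pi> = map_pmf (\<lambda>q. (q, 2)) \<rho>"
    then show "\<forall>l. pmf \<pi> (l, 1) = 0" by (auto simp: pmf_eq_0_set_pmf)
  qed
  show ?thesis unfolding sat_stationary_def phase
    using bind injD[OF pmf.inj_map[OF inj]] by metis
qed

lemma z_sat_eq:
  assumes "0 < p_i" "p_i < 1" "0 < p_j" "p_j < 1" "0 \<le> lam_j" "lam_j \<le> 1"
  defines "s \<equiv> p_j * (1 - p_i)"
  shows "z_sat lam_i p_i lam_j p_j = (if lam_j < s then (s - lam_j) / (s * (1 - lam_j)) else 0)"
proof -
  have s: "0 < s" "s < 1" using assms(1-4) mult_strict_mono[of p_j 1 "1 - p_i" 1] by (auto simp: s_def)
  have iff: "sat_stationary lam_i p_i lam_j p_j \<pi> \<longleftrightarrow>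
      (\<exists>\<rho>. \<pi> = map_pmf (\<lambda>q. (q, 2)) \<rho> \<and> bind_pmf \<rho> (bernoulli_walk lam_j s) = \<rho>)" for \<pi>
    unfolding s_def using assms by (intro sat_stationary_iff) auto
  show ?thesis
  proof (cases "lam_j < s")
    case True
    then obtain \<rho> where stat: "bind_pmf \<rho> (bernoulli_walk lam_j s) = \<rho>"
      using bernoulli_walk_exists[of lam_j s] assms(5) s by auto
    have the: "(THE \<pi>. sat_stationary lam_i p_i lam_j p_j \<pi>) = map_pmf (\<lambda>q. (q, 2)) \<rho>"
      using stat bernoulli_walk_unique[of lam_j s] assms(5) s True unfolding iff
      by (intro the_equality) auto
    have level: "level_prob (map_pmf (\<lambda>q. (q, 2)) \<rho>) l = pmf \<rho> l" for l
      by (simp add: level_prob_def vimage_def measure_pmf_single)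
    note st = stationary_bernoulli_walk[OF assms(5,6) _ _ stat]
    have 0: "pmf \<rho> 0 = 1 - lam_j / s" using st(3) s by (simp add: field_simps)
    have 1: "pmf \<rho> 1 = lam_j * (1 - lam_j / s) / (s * (1 - lam_j))"
      using st(1) s True by (simp add: 0 eq_divide_eq)
    have "\<exists>\<pi>. sat_stationary lam_i p_i lam_j p_j \<pi>" using iff stat by blast
    \<comment> \<open>For \<open>lam_j = 0\<close> level 0 has mass 1, and the convention
      \<open>z = 1\<close> agrees with the formula.\<close>
    then show ?thesis
      using True s by (auto simp: z_sat_def the level 0 1[unfolded One_nat_def] Let_def divide_simps)
  next
    case False
    then have "\<nexists>\<pi>. sat_stationary lam_i p_i lam_j p_j \<pi>"
      using iff bernoulli_walk_not_exists[of s lam_j] s assms(6) by auto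
    then show ?thesis using False by (simp add: z_sat_def)
  qed
qed

text \<open>Adding the blocks forgets the level. Phase 1 is left on an arrival, phase 2 when a lone
  transmission removes the last packet and no arrival follows.\<close>

lemma A_mat_entries:
  assumes "0 \<le> p_i" "p_i \<le> 1" "0 \<le> p_j" "p_j \<le> 1" "0 \<le> lam_i" "lam_i \<le> 1" "0 \<le> lam_j" "lam_j \<le> 1" "0 \<le> z" "z \<le> 1"
  defines "A \<equiv> A_mat lam_i p_i lam_j p_j z"
  shows "A $ 1 $ 1 = 1 - lam_j" "A $ 1 $ 2 = lam_j"
    "A $ 2 $ 1 = p_j * (1 - p_i) * z * (1 - lam_j)" "A $ 2 $ 2 = 1 - p_j * (1 - p_i) * z * (1 - lam_j)"
  using assms(1-10)
  by (simp_all add: A_def A_mat_def A0_def A1_def A2_def level_block_def mc_step_def pmf_bind pmf_return Let_def)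
     (simp_all add: algebra_simps)

text \<open>The balance equation of the two-state chain makes the mass of phase 2 the load
  \<open>lam_j / s\<close>. From load 1 on, \<open>z = 0\<close> makes phase 2 absorbing.\<close>

lemma alpha_sat:
  assumes "0 < p_i" "p_i < 1" "0 < p_j" "p_j < 1" "0 \<le> lam_i" "lam_i \<le> 1" "0 \<le> lam_j" "lam_j \<le> 1"
  defines "s \<equiv> p_j * (1 - p_i)"
  shows "alpha_sat lam_i p_i lam_j p_j $ 2 = min 1 (lam_j / s)"
    and "alpha_sat lam_i p_i lam_j p_j $ 1 = 1 - min 1 (lam_j / s)"
proof -
  have s: "0 < s" "s < 1" using assms(1-4) mult_strict_mono[of p_j 1 "1 - p_i" 1] by (auto simp: s_def)
  define z where "z = z_sat lam_i p_i lam_j p_j"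
  have z: "z = (if lam_j < s then (s - lam_j) / (s * (1 - lam_j)) else 0)"
    unfolding z_def s_def using assms by (intro z_sat_eq) auto
  have "s - lam_j \<le> s * (1 - lam_j)"
    using s mult_left_le_one_le[of lam_j s] assms(7) by (simp add: right_diff_distrib)
  then have z01: "0 \<le> z" "z \<le> 1" using s by (auto simp: z divide_le_eq_1)
  \<comment> \<open>This is the rate out of phase 2, in which the denominator of \<open>z\<close>
    cancels.\<close>
  have out: "s * z * (1 - lam_j) = max 0 (s - lam_j)"
    using s by (auto simp: z)
  define m where "m = max 0 (s - lam_j)"
  have entries: "A_mat lam_i p_i lam_j p_j z $ 1 $ 1 = 1 - lam_j" "A_mat lam_i p_i lam_j p_j z $ 1 $ 2 = lam_j"
    "A_mat lam_i p_i lam_j p_j z $ 2 $ 1 = m" "A_mat lam_i p_i lam_j p_j z $ 2 $ 2 = 1 - m"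
    using A_mat_entries[of p_i p_j lam_i lam_j z] assms(1-8) z01 out by (simp_all add: s_def m_def)
  have "stationary_vec (A_mat lam_i p_i lam_j p_j z) \<alpha> \<longleftrightarrow> \<alpha> = (\<chi> h. if h = 2 then min 1 (lam_j / s) else 1 - min 1 (lam_j / s))" for \<alpha>
  proof -
    have "stationary_vec (A_mat lam_i p_i lam_j p_j z) \<alpha> \<longleftrightarrow> 0 \<le> \<alpha> $ 1 \<and> 0 \<le> \<alpha> $ 2 \<and> \<alpha> $ 1 + \<alpha> $ 2 = 1
        \<and> lam_j * \<alpha> $ 1 = m * \<alpha> $ 2"
      by (auto simp: entries stationary_vec_def vector_matrix_mult_def vec_eq_iff sum_2 forall_2 algebra_simps)
    also have "\<dots> \<longleftrightarrow> \<alpha> $ 2 = min 1 (lam_j / s) \<and> \<alpha> $ 1 = 1 - min 1 (lam_j / s)"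
    proof (cases "lam_j < s")
      case True
      then have "min 1 (lam_j / s) = lam_j / s" "m = s - lam_j" using s by (auto simp: m_def)
      moreover have "lam_j * \<alpha> $ 1 = m * \<alpha> $ 2 \<longleftrightarrow> \<alpha> $ 2 = lam_j / s" if "\<alpha> $ 1 = 1 - \<alpha> $ 2"
        unfolding that \<open>m = s - lam_j\<close> using s by (auto simp: eq_divide_eq algebra_simps)
      moreover have "0 \<le> lam_j / s" "lam_j / s \<le> 1" using s True assms(7) by simp_all
      ultimately show ?thesis by (auto simp: eq_diff_eq)
    next
      case False
      then have "min 1 (lam_j / s) = 1" "m = 0" "lam_j \<noteq> 0" using s by (auto simp: m_def)
      then show ?thesis by auto
    qed
    finally show ?thesis by (auto simp: vec_eq_iff forall_2)
  qed
  then have "alpha_sat lam_i p_i lam_j p_j = (\<chi> h. if h = 2 then min 1 (lam_j / s) else 1 - min 1 (lam_j / s))"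
    unfolding alpha_sat_def z_def[symmetric] by auto
  then show "alpha_sat lam_i p_i lam_j p_j $ 2 = min 1 (lam_j / s)"
    "alpha_sat lam_i p_i lam_j p_j $ 1 = 1 - min 1 (lam_j / s)" by auto
qed

text \<open>In the second branch the other node is saturated as well, and the border no longer
  depends on \<open>lam_j\<close>.\<close>

lemma lam_SR_eq:
  assumes "0 < p_i" "p_i < 1" "0 < p_j" "p_j < 1" "0 \<le> lam_i" "lam_i \<le> 1" "0 \<le> lam_j" "lam_j \<le> 1"
  shows "lam_SR lam_i p_i lam_j p_j =
    (if lam_j \<le> p_j * (1 - p_i) then p_i * (1 - lam_j / (1 - p_i)) else p_i * (1 - p_j))"
proof -
  have "lam_SR lam_i p_i lam_j p_j = p_i * (1 - p_j * min 1 (lam_j / (p_j * (1 - p_i))))"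
    unfolding lam_SR_def by (simp add: sum_2 p_suc_def alpha_sat[OF assms]) algebra
  moreover have "0 < p_j * (1 - p_i)" using assms by simp
  ultimately show ?thesis using assms(1-4) by (auto simp: min_def)
qed

section \<open>The queue lengths of the network\<close>

locale aloha =
  fixes lam1 p1 lam2 p2 :: real
  assumes p1: "0 < p1" "p1 < 1" and p2: "0 < p2" "p2 < 1"
    and lam1: "0 \<le> lam1" "lam1 \<le> 1" and lam2: "0 \<le> lam2" "lam2 \<le> 1"
begin

abbreviation "step \<equiv> aloha_step lam1 p1 lam2 p2"

definition "s1 = p1 * (1 - p2)"

definition "s2 = p2 * (1 - p1)"

lemma s1: "0 < s1" "s1 < p1"
  using p1 p2 by (auto simp: s1_def)

lemma s2: "0 < s2" "s2 < p2"
  using p1 p2 by (auto simp: s2_def)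

definition arrive :: "(nat \<times> nat \<Rightarrow> real) \<Rightarrow> nat \<Rightarrow> nat \<Rightarrow> real" where
  "arrive f x y = (1 - lam1) * (1 - lam2) * f (x, y) + lam1 * (1 - lam2) * f (Suc x, y)
    + (1 - lam1) * lam2 * f (x, Suc y) + lam1 * lam2 * f (Suc x, Suc y)"

lemma finite_set_step [simp]: "finite (set_pmf (step q))"
  by (cases q) (simp add: aloha_step_def departures_def split: prod.split)

lemma drift_step:
  "drift step f (Suc x, Suc y) = s1 * arrive f x (Suc y) + s2 * arrive f (Suc x) y
    + (1 - s1 - s2) * arrive f (Suc x) (Suc y) - f (Suc x, Suc y)"
  "drift step f (Suc x, 0) = p1 * arrive f x 0 + (1 - p1) * arrive f (Suc x) 0 - f (Suc x, 0)"
  "drift step f (0, Suc y) = p2 * arrive f 0 y + (1 - p2) * arrive f 0 (Suc y) - f (0, Suc y)"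
  "drift step f (0, 0) = arrive f 0 0 - f (0, 0)"
  using p1 p2 lam1 lam2
  by (simp_all add: drift_def aloha_step_def departures_def bind_assoc_pmf bind_return_pmf
      expectation_bernoulli_bind arrive_def s1_def s2_def)
     (simp_all add: algebra_simps)

lemma set_step:
  assumes "y \<in> set_pmf (step x)"
  shows "\<bar>real (fst y) - real (fst x)\<bar> \<le> 1" "\<bar>real (snd y) - real (snd x)\<bar> \<le> 1"
  using assms by (auto simp: aloha_step_def departures_def split: prod.splits)

lemma drift_linear:
  "drift step (\<lambda>(x, y). u * real x + v * real y) =
    (\<lambda>(x, y). if x > 0 \<and> y > 0 then u * (lam1 - s1) + v * (lam2 - s2)
      else if x > 0 then u * (lam1 - p1) + v * lam2
      else if y > 0 then u * lam1 + v * (lam2 - p2)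
      else u * lam1 + v * lam2)" (is "?L = ?R")
proof
  fix q :: "nat \<times> nat"
  obtain x y where "q = (x, y)" by fastforce
  then show "?L q = ?R q"
    by (cases x; cases y) (simp_all add: drift_step arrive_def algebra_simps)
qed

text \<open>The coefficients of \<open>2 * x\<close> and \<open>2 * y\<close> are the drifts of
  \<open>a x + b y\<close> and \<open>b x + c y\<close>; the rest is the mean of the form at the
  increment. The term \<open>- s1 * s2\<close> arises because the two departures exclude each
  other.\<close>

lemma drift_quadratic:
  fixes a b c :: real
  defines "V \<equiv> (\<lambda>(x, y). a * (real x)\<^sup>2 + 2 * b * real x * real y + c * (real y)\<^sup>2)"
  shows "x > 0 \<Longrightarrow> y > 0 \<Longrightarrow> drift step V (x, y) =
      2 * real x * (a * (lam1 - s1) + b * (lam2 - s2)) + 2 * real y * (b * (lam1 - s1) + c * (lam2 - s2))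
      + (a * (lam1 + s1 - 2 * lam1 * s1) + c * (lam2 + s2 - 2 * lam2 * s2)
        + 2 * b * ((lam1 - s1) * (lam2 - s2) - s1 * s2))"
    and "x > 0 \<Longrightarrow> drift step V (x, 0) = 2 * real x * (a * (lam1 - p1) + b * lam2)
      + (a * (lam1 + p1 - 2 * lam1 * p1) + 2 * b * lam2 * (lam1 - p1) + c * lam2)"
    and "y > 0 \<Longrightarrow> drift step V (0, y) = 2 * real y * (b * lam1 + c * (lam2 - p2))
      + (a * lam1 + 2 * b * lam1 * (lam2 - p2) + c * (lam2 + p2 - 2 * lam2 * p2))"
    and "drift step V (0, 0) = a * lam1 + 2 * b * lam1 * lam2 + c * lam2"
     apply (cases x; cases y; simp add: V_def drift_step arrive_def power2_eq_square algebra_simps)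
    apply (cases x; simp add: V_def drift_step arrive_def power2_eq_square algebra_simps)
   apply (cases y; simp add: V_def drift_step arrive_def power2_eq_square algebra_simps)
  apply (simp add: V_def drift_step arrive_def power2_eq_square algebra_simps)
  done

text \<open>This is the part of the region where queue 2 is stable next to a saturated
  \<open>N1\<close>; exchanging the nodes gives the other part.\<close>

lemma stationary_exists:
  assumes lt2: "lam2 < s2" and lt1: "lam1 < p1 * (1 - lam2 / (1 - p1))"
  shows "\<exists>\<pi>. bind_pmf \<pi> step = \<pi>"
proof -
  have lt1': "0 < (1 - p1) * (p1 - lam1) - p1 * lam2"
    using lt1 p1 by (simp add: field_simps)
  then have "0 < (1 - p1) * (p1 - lam1)"
    using p1 lam2 by (smt (verit) mult_nonneg_nonneg)
  then have "lam1 < p1" using p1 by (simp add: zero_less_mult_iff)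
  \<comment> \<open>The difference of the two sides is \<open>p2\<close> times the slack in the
    border condition; it leaves room for \<open>r\<close> between its bounds.\<close>
  have key: "lam2 * (lam1 - s1) < (p1 - lam1) * (s2 - lam2)"
  proof -
    have "(p1 - lam1) * (s2 - lam2) - lam2 * (lam1 - s1) = p2 * ((1 - p1) * (p1 - lam1) - p1 * lam2)"
      by (simp add: s1_def s2_def algebra_simps)
    then show ?thesis using lt1' p2 by (smt (verit) mult_pos_pos)
  qed
  \<comment> \<open>\<open>r\<close> and \<open>R\<close> are the slopes of linear functions \<open>x + r y\<close>, \<open>x + R y\<close> that decrease in the interior
    and also on the axes \<open>y = 0\<close> and \<open>x = 0\<close>, respectively.\<close>
  obtain r where r: "0 < r" "lam1 - s1 < r * (s2 - lam2)" "r * lam2 < p1 - lam1"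
  proof (cases "lam2 = 0")
    case True
    show ?thesis
      using that[of "(\<bar>lam1 - s1\<bar> + 1) / (s2 - lam2)"] lt2 \<open>lam1 < p1\<close> True by simp
  next
    case False
    define l where "l = max 0 ((lam1 - s1) / (s2 - lam2))"
    have "l < (p1 - lam1) / lam2"
      using key lt2 \<open>lam1 < p1\<close> False lam2 by (auto simp: l_def field_simps)
    then obtain r where "l < r" "r < (p1 - lam1) / lam2" using dense by blast
    then show ?thesis using that[of r] lt2 False lam2 by (auto simp: l_def field_simps)
  qed
  \<comment> \<open>As \<open>lam2 < s2 < p2\<close>, a larger slope only helps in the interior and
    on \<open>x = 0\<close>; \<open>1 + lam1\<close> is large enough for both.\<close>
  define R where "R = (1 + lam1) / (s2 - lam2)"
  have R: "0 < R" "R * (s2 - lam2) = 1 + lam1" using lt2 lam1 by (auto simp: R_def)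
  then have "R * (p2 - lam2) > 1 + lam1" using s2 mult_strict_left_mono[of "s2 - lam2" "p2 - lam2" R] by auto
  \<comment> \<open>The partial derivatives of \<open>V\<close> are \<open>2 (x + r y)\<close> and
    \<open>2 r (x + R y)\<close>. Only the first matters for growth along \<open>y = 0\<close>, only
    the second along \<open>x = 0\<close>.\<close>
  define V :: "nat \<times> nat \<Rightarrow> real" where
    "V = (\<lambda>(x, y). 1 * (real x)\<^sup>2 + 2 * r * real x * real y + r * R * (real y)\<^sup>2)"
  define i1 i2 xa ya where "i1 = 1 * (lam1 - s1) + r * (lam2 - s2)" and "i2 = r * (lam1 - s1) + r * R * (lam2 - s2)"
    and "xa = 1 * (lam1 - p1) + r * lam2" and "ya = r * lam1 + r * R * (lam2 - p2)"
  have neg: "i1 < 0" "i2 < 0" "xa < 0" "ya < 0"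
  proof -
    show "i1 < 0" "xa < 0" using r by (auto simp: i1_def xa_def algebra_simps)
    have "i2 = r * ((lam1 - s1) - R * (s2 - lam2))" "ya = r * (lam1 - R * (p2 - lam2))"
      by (auto simp: i2_def ya_def algebra_simps)
    then show "i2 < 0" "ya < 0" using r s1 R \<open>R * (p2 - lam2) > 1 + lam1\<close> by (auto simp: mult_less_0_iff)
  qed
  define \<delta> where "\<delta> = Min {-i1, -i2, -xa, -ya}"
  have \<delta>: "0 < \<delta>" "i1 \<le> - \<delta>" "i2 \<le> - \<delta>" "xa \<le> - \<delta>" "ya \<le> - \<delta>"
    using neg by (auto simp: \<delta>_def)
  obtain C where C: "drift step V (x, y) \<le> C - 2 * \<delta> * (real x + real y)" for x y
  proof -
    note dq = drift_quadratic[where a=1 and b=r and c="r * R", folded V_def i1_def i2_def xa_def ya_def]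
    obtain ci cx cy c0 where c:
      "x > 0 \<Longrightarrow> y > 0 \<Longrightarrow> drift step V (x, y) = 2 * real x * i1 + 2 * real y * i2 + ci"
      "x > 0 \<Longrightarrow> drift step V (x, 0) = 2 * real x * xa + cx"
      "y > 0 \<Longrightarrow> drift step V (0, y) = 2 * real y * ya + cy"
      "drift step V (0, 0) = c0" for x y
      using dq by blast
    have mono: "2 * real x * i \<le> - 2 * \<delta> * real x" if "i \<le> - \<delta>" for i x
      using mult_left_mono[OF that, of "2 * real x"] by simp
    have "drift step V (x, y) \<le> Max {ci, cx, cy, c0} - 2 * \<delta> * (real x + real y)" for x y
    proof -
      have M: "ci \<le> Max {ci, cx, cy, c0}" "cx \<le> Max {ci, cx, cy, c0}" "cy \<le> Max {ci, cx, cy, c0}" "c0 \<le> Max {ci, cx, cy, c0}"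
        by auto
      consider "x > 0" "y > 0" | "x > 0" "y = 0" | "x = 0" "y > 0" | "x = 0" "y = 0" by blast
      then show ?thesis
      proof cases
        case 1
        with c(1)[of x y] show ?thesis
          unfolding distrib_left using M(1) mono[OF \<delta>(2), of x] mono[OF \<delta>(3), of y] by linarith
      next
        case 2
        with c(2)[of x] show ?thesis unfolding distrib_left using M(2) mono[OF \<delta>(4), of x] by (simp only: of_nat_0; linarith)
      next
        case 3
        with c(3)[of y] show ?thesis unfolding distrib_left using M(3) mono[OF \<delta>(5), of y] by (simp only: of_nat_0; linarith)
      next
        case 4
        with c(4) show ?thesis using M(4) by simp
      qed
    qed
    then show ?thesis using that by blast
  qed
  define N where "N = nat \<lceil>(C + 1) / (2 * \<delta>)\<rceil>"
  show ?thesis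
  proof (rule foster_stationary[where V=V and F="{..N} \<times> {..N}" and \<epsilon>=1])
    show "finite {x. y \<in> set_pmf (step x)}" for y
    proof (rule finite_subset)
      show "{x. y \<in> set_pmf (step x)} \<subseteq> {..Suc (fst y)} \<times> {..Suc (snd y)}"
        using set_step[of y] by (auto simp: abs_le_iff) fastforce+
    qed simp
    show "0 \<le> V q" for q using r R by (auto simp: V_def split: prod.split)
    fix q :: "nat \<times> nat" assume q: "q \<notin> {..N} \<times> {..N}"
    obtain x y where xy: "q = (x, y)" by fastforce
    have "real N \<le> real x + real y" using q xy by auto
    then have "(C + 1) / (2 * \<delta>) \<le> real x + real y" unfolding N_def by linarith
    then have "C + 1 \<le> 2 * \<delta> * (real x + real y)" using \<delta>(1) by (simp add: field_simps)
    then show "drift step V q \<le> - 1" using C[of x y] xy by simp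
  qed auto
qed

subsection \<open>Consequences of stationarity\<close>

lemma set_stationary:
  assumes "bind_pmf \<pi> step = \<pi>" "x \<in> set_pmf \<pi>" "y \<in> set_pmf (step x)"
  shows "y \<in> set_pmf \<pi>"
  using assms by (metis UN_I set_bind_pmf)

lemma stationary_drift_linear:
  assumes "bind_pmf \<pi> step = \<pi>"
  shows "integrable \<pi> (drift step (\<lambda>(x, y). u * real x + v * real y))"
    and "measure_pmf.expectation \<pi> (drift step (\<lambda>(x, y). u * real x + v * real y)) = 0"
proof -
  have "\<bar>(case y of (x, y) \<Rightarrow> u * real x + v * real y) - (case x of (x, y) \<Rightarrow> u * real x + v * real y)\<bar> \<le> \<bar>u\<bar> + \<bar>v\<bar>"
    if "y \<in> set_pmf (step x)" for x y
  proof -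
    have "\<bar>u * (real (fst y) - real (fst x)) + v * (real (snd y) - real (snd x))\<bar> \<le> \<bar>u\<bar> * 1 + \<bar>v\<bar> * 1"
      using set_step[OF that] by (intro order_trans[OF abs_triangle_ineq] add_mono) (auto simp: abs_mult mult_left_le)
    then show ?thesis by (simp add: split_beta algebra_simps)
  qed
  note * = stationary_drift_zero[OF assms finite_set_step, of "\<lambda>(x, y). u * real x + v * real y", OF this]
  from *
  show "integrable \<pi> (drift step (\<lambda>(x, y). u * real x + v * real y))"
    "measure_pmf.expectation \<pi> (drift step (\<lambda>(x, y). u * real x + v * real y)) = 0" by blast+
qed

text \<open>\<open>a\<close>, \<open>b\<close>, \<open>c\<close> are the masses of the interior and
  of the two axes without the origin; the equations say that the coordinates have mean drift
  zero.\<close>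

lemma stationary_rates:
  assumes stat: "bind_pmf \<pi> step = \<pi>"
  obtains a b c where "0 \<le> a" "0 \<le> b" "0 \<le> c" "a + b + c + pmf \<pi> (0, 0) = 1"
    "lam1 = s1 * a + p1 * b" "lam2 = s2 * a + p2 * c"
proof -
  define A B C :: "(nat \<times> nat) set"
    where "A = {q. fst q > 0 \<and> snd q > 0}" and "B = {q. fst q > 0 \<and> snd q = 0}" and "C = {q. fst q = 0 \<and> snd q > 0}"
  have int: "measure_pmf.expectation \<pi> (\<lambda>q. k + l * indicator X q + m * indicator Y q) = k + l * measure_pmf.prob \<pi> X + m * measure_pmf.prob \<pi> Y"
    for k l m X Y
    by (simp add: measure_pmf.emeasure_eq_measure)
  have "drift step (\<lambda>(x, y). 1 * real x + 0 * real y) = (\<lambda>q. lam1 + (- s1) * indicator A q + (- p1) * indicator B q)"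
    unfolding drift_linear by (auto simp: fun_eq_iff A_def B_def split: split_indicator)
  then have 1: "lam1 = s1 * measure_pmf.prob \<pi> A + p1 * measure_pmf.prob \<pi> B"
    using stationary_drift_linear(2)[OF stat, of 1 0] int[of lam1 "- s1" A "- p1" B] by simp
  have "drift step (\<lambda>(x, y). 0 * real x + 1 * real y) = (\<lambda>q. lam2 + (- s2) * indicator A q + (- p2) * indicator C q)"
    unfolding drift_linear by (auto simp: fun_eq_iff A_def C_def split: split_indicator)
  then have 2: "lam2 = s2 * measure_pmf.prob \<pi> A + p2 * measure_pmf.prob \<pi> C"
    using stationary_drift_linear(2)[OF stat, of 0 1] int[of lam2 "- s2" A "- p2" C] by simp
  have "measure_pmf.prob \<pi> (A \<union> B \<union> C \<union> {(0, 0)}) =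
      measure_pmf.prob \<pi> A + measure_pmf.prob \<pi> B + measure_pmf.prob \<pi> C + measure_pmf.prob \<pi> {(0, 0)}"
    by (subst measure_pmf.finite_measure_Union; (auto simp: A_def B_def C_def)[1])+
  moreover have "A \<union> B \<union> C \<union> {(0, 0)} = UNIV" by (auto simp: A_def B_def C_def)
  ultimately show ?thesis
    using that[of "measure_pmf.prob \<pi> A" "measure_pmf.prob \<pi> B" "measure_pmf.prob \<pi> C"] 1 2
    by (simp add: measure_pmf_single)
qed

text \<open>In each state the success probability of a node is its arrival rate minus the drift of
  its queue, and that drift has mean zero.\<close>

lemma stable_iff: "aloha_stable lam1 p1 lam2 p2 \<longleftrightarrow> (\<exists>\<pi>. bind_pmf \<pi> step = \<pi>)"
proof -
  have "measure_pmf.prob (bind_pmf \<pi> (departures p1 p2)) {d. fst d} = lam1 \<and>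
      measure_pmf.prob (bind_pmf \<pi> (departures p1 p2)) {d. snd d} = lam2" if stat: "bind_pmf \<pi> step = \<pi>" for \<pi>
  proof -
    have dep: "measure_pmf.prob (bind_pmf \<pi> (departures p1 p2)) D =
        measure_pmf.expectation \<pi> (\<lambda>q. measure_pmf.prob (departures p1 p2 q) D)" for D
      using expectation_bind_bounded[of "indicator D" 1 \<pi> "departures p1 p2"] by simp
    have bern: "measure_pmf.prob (bind_pmf (bernoulli_pmf p) k) D =
        p * measure_pmf.prob (k True) D + (1 - p) * measure_pmf.prob (k False) D"
      if "0 \<le> p" "p \<le> 1" for p D and k :: "bool \<Rightarrow> (bool \<times> bool) pmf"
      using expectation_bind_bounded[of "indicator D" 1 "bernoulli_pmf p" k] that by simp
    have "measure_pmf.prob (departures p1 p2 q) {d. fst d} = lam1 - drift step (\<lambda>(x, y). 1 * real x + 0 * real y) q"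
      "measure_pmf.prob (departures p1 p2 q) {d. snd d} = lam2 - drift step (\<lambda>(x, y). 0 * real x + 1 * real y) q" for q
      using p1 p2 unfolding drift_linear
      by (auto simp: departures_def bern s1_def s2_def split: prod.split)
    then show ?thesis
      using stationary_drift_linear[OF stat, of 1 0] stationary_drift_linear[OF stat, of 0 1]
      unfolding dep by simp
  qed
  then show ?thesis unfolding aloha_stable_def by blast
qed

end

section \<open>Criteria against stationarity\<close>

lemma expectation_ge_point:
  fixes g :: "'a \<Rightarrow> real"
  assumes "finite (set_pmf p)" "\<And>z. z \<in> set_pmf p \<Longrightarrow> 0 \<le> g z"
  shows "pmf p y * g y \<le> measure_pmf.expectation p g"
proof -
  have "measure_pmf.expectation p (\<lambda>z. g y * indicator {y} z) \<le> measure_pmf.expectation p g"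
    using assms by (intro expectation_mono) (auto split: split_indicator)
  then show ?thesis by (simp add: measure_pmf_single mult.commute)
qed

lemma drift_diff:
  assumes "finite (set_pmf (K x))"
  shows "drift K (\<lambda>q. f q - M * g q) x = drift K f x - M * drift K g x"
  using assms unfolding drift_def
  by (subst Bochner_Integration.integral_diff) (auto simp: integrable_measure_pmf_finite algebra_simps)

lemma drift_cmult: "drift K (\<lambda>q. c * g q) x = c * drift K g x"
  by (simp add: drift_def right_diff_distrib)

lemma drift_mono_plus:
  assumes "finite (set_pmf (K x))" "\<And>y. y \<in> set_pmf (K x) \<Longrightarrow> f y - f x \<le> g y - g x + c"
  shows "drift K f x \<le> drift K g x + c"
proof -
  have "measure_pmf.expectation (K x) (\<lambda>y. f y + (g x - f x - c)) \<le> measure_pmf.expectation (K x) g"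
    using assms by (intro expectation_mono) (auto simp: algebra_simps)
  then show ?thesis
    using assms(1) by (simp add: drift_def integrable_measure_pmf_finite)
qed

lemmas drift_mono = drift_mono_plus[where c=0, simplified]

lemma drift_max:
  assumes "finite (set_pmf (K x))"
  shows "f x \<le> k \<Longrightarrow> 0 \<le> drift K (\<lambda>q. max (f q) k) x"
    and "k \<le> f x \<Longrightarrow> drift K f x \<le> drift K (\<lambda>q. max (f q) k) x"
proof -
  assume "f x \<le> k"
  then have "drift K (\<lambda>_. 0) x \<le> drift K (\<lambda>q. max (f q) k) x"
    using assms by (intro drift_mono) auto
  then show "0 \<le> drift K (\<lambda>q. max (f q) k) x" by (simp add: drift_def)
next
  assume "k \<le> f x"
  then show "drift K f x \<le> drift K (\<lambda>q. max (f q) k) x"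
    using assms by (intro drift_mono) auto
qed

text \<open>The truncation \<open>max f k\<close> has nonnegative drift of mean zero, so its drift
  vanishes on the support; where \<open>f\<close> exceeds \<open>k\<close> it would be
  positive.\<close>

lemma stationary_subharmonic_bound:
  fixes f :: "'a \<Rightarrow> real"
  assumes stat: "bind_pmf \<pi> K = \<pi>"
    and fin: "\<And>x. finite (set_pmf (K x))"
    and inc: "\<And>x y. y \<in> set_pmf (K x) \<Longrightarrow> \<bar>f y - f x\<bar> \<le> B"
    and pos: "\<And>x. k < f x \<Longrightarrow> 0 < drift K f x"
    and x: "x \<in> set_pmf \<pi>"
  shows "f x \<le> k"
proof (rule ccontr)
  assume "\<not> f x \<le> k"
  define g where "g = (\<lambda>q. max (f q) k)"
  have "\<bar>g y - g x\<bar> \<le> B" if "y \<in> set_pmf (K x)" for x y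
    using inc[OF that] by (auto simp: g_def)
  note st = stationary_drift_zero[OF stat fin this]
  have nonneg: "0 \<le> drift K g z" for z
    using drift_max[where K=K and f=f and k=k and x=z, OF fin] pos[of z] unfolding g_def by fastforce
  then have "AE z in \<pi>. drift K g z = 0"
    using st integral_nonneg_eq_0_iff_AE[of \<pi> "drift K g"] by simp
  then have "drift K g x = 0" using x by (simp add: AE_measure_pmf_iff)
  moreover have "drift K f x \<le> drift K g x" "0 < drift K f x"
    using drift_max(2)[where K=K and f=f and k=k and x=x, OF fin] pos[of x] \<open>\<not> f x \<le> k\<close> unfolding g_def by auto
  ultimately show False by simp
qed

text \<open>Replacing \<open>W\<^sup>2\<close> beyond level \<open>R\<close> by the tangent \<open>2 R W - R\<^sup>2\<close> bounds the increments; the drift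
  becomes at worst \<open>- C\<^sup>2\<close>, uniformly in \<open>R\<close>, and only on \<open>{W > R - C}\<close>, whose probability
  vanishes as \<open>R \<rightarrow> \<infinity>\<close>.\<close>

lemma stationary_square_drift_bound:
  fixes W :: "'a \<Rightarrow> real"
  assumes stat: "bind_pmf \<pi> K = \<pi>"
    and fin: "\<And>x. finite (set_pmf (K x))"
    and W0: "\<And>x. 0 \<le> W x"
    and inc: "\<And>x y. y \<in> set_pmf (K x) \<Longrightarrow> \<bar>W y - W x\<bar> \<le> C"
    and eps: "0 < \<epsilon>"
    and pos: "\<And>x. k < (W x)\<^sup>2 \<Longrightarrow> \<epsilon> \<le> drift K (\<lambda>q. (W q)\<^sup>2) x"
    and x0: "x0 \<in> set_pmf \<pi>"
  shows "(W x0)\<^sup>2 \<le> k"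
proof (rule ccontr)
  assume k: "\<not> (W x0)\<^sup>2 \<le> k"
  have C0: "0 \<le> C"
  proof -
    obtain y where "y \<in> set_pmf (K x0)" using set_pmf_not_empty by fastforce
    then show ?thesis using inc[of y x0] by linarith
  qed
  have key: "\<epsilon> * pmf \<pi> x0 \<le> C\<^sup>2 * measure_pmf.prob \<pi> {x. real n < W x}" if n: "W x0 \<le> real n" for n
  proof -
    \<comment> \<open>The margin \<open>C\<close> keeps every step from a state with
      \<open>W x \<le> n\<close> where \<open>\<psi>\<close> is still the square.\<close>
    define R where "R = real n + C"
    have R0: "0 \<le> R" using C0 by (simp add: R_def)
    define \<psi> where "\<psi> w = (if w \<le> R then w\<^sup>2 else 2 * R * w - R\<^sup>2)" for w :: real
    have psi_le: "\<psi> w \<le> w\<^sup>2" and psi_ge: "2 * R * w - R\<^sup>2 \<le> \<psi> w" for w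
      using sum_squares_ge_zero[of "w - R" 0] by (auto simp: \<psi>_def power2_eq_square algebra_simps)
    have psi_lip: "0 \<le> \<psi> v - \<psi> w \<and> \<psi> v - \<psi> w \<le> 2 * R * (v - w)" if w: "0 \<le> w" "w \<le> v" for v w
    proof -
      consider "v \<le> R" | "w \<le> R" "R < v" | "R < w" using w by linarith
      then show ?thesis
      proof cases
        case 1
        have "v\<^sup>2 - w\<^sup>2 = (v + w) * (v - w)" by (simp add: power2_eq_square algebra_simps)
        then show ?thesis
          using 1 w mult_right_mono[of "v + w" "2 * R" "v - w"] by (simp add: \<psi>_def)
      next
        case 2
        have "2 * R * v - R\<^sup>2 - w\<^sup>2 = 2 * R * (v - w) - (R - w)\<^sup>2"
          "2 * R * v - R\<^sup>2 - w\<^sup>2 = 2 * R * (v - R) + (R + w) * (R - w)"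
          by (simp_all add: power2_eq_square algebra_simps)
        moreover have "0 \<le> 2 * R * (v - R)" "0 \<le> (R + w) * (R - w)" "0 \<le> (R - w)\<^sup>2"
          using 2 w R0 by simp_all
        ultimately show ?thesis using 2 by (simp add: \<psi>_def)
      next
        case 3
        then show ?thesis using w R0 by (simp add: \<psi>_def right_diff_distrib mult_left_mono)
      qed
    qed
    define f where "f = (\<lambda>q. max (\<psi> (W q)) k)"
    have "\<bar>f y - f x\<bar> \<le> 2 * R * C" if "y \<in> set_pmf (K x)" for x y
    proof -
      have "\<bar>\<psi> (W y) - \<psi> (W x)\<bar> \<le> 2 * R * \<bar>W y - W x\<bar>"
        using psi_lip[OF W0, of x "W y"] psi_lip[OF W0, of y "W x"] by (cases "W x \<le> W y") auto
      also have "\<dots> \<le> 2 * R * C" using inc[OF that] R0 by (intro mult_left_mono) auto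
      finally show ?thesis by (auto simp: f_def)
    qed
    note st = stationary_drift_zero[OF stat fin this]
    have low: "\<epsilon> * indicator {x0} x - C\<^sup>2 * indicator {x. real n < W x} x \<le> drift K f x" for x
    proof (cases "\<psi> (W x) \<le> k")
      case True
      have "x \<noteq> x0" using True k n C0 by (auto simp: \<psi>_def R_def)
      moreover have "0 \<le> drift K f x"
        using drift_max(1)[where K=K and f="\<lambda>q. \<psi> (W q)" and k=k and x=x, OF fin] True by (simp add: f_def)
      then have "- C\<^sup>2 \<le> drift K f x" using zero_le_power2[of C] by linarith
      ultimately show ?thesis using \<open>0 \<le> drift K f x\<close> by (simp split: split_indicator)
    next
      case False
      then have ge: "drift K (\<lambda>q. \<psi> (W q)) x \<le> drift K f x"
        using drift_max(2)[where K=K and f="\<lambda>q. \<psi> (W q)" and k=k and x=x, OF fin] by (simp add: f_def)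
      have p: "\<epsilon> \<le> drift K (\<lambda>q. (W q)\<^sup>2) x" using False psi_le[of "W x"] by (intro pos) linarith
      show ?thesis
      proof (cases "W x \<le> real n")
        case True
        have "drift K (\<lambda>q. (W q)\<^sup>2) x \<le> drift K (\<lambda>q. \<psi> (W q)) x"
          using inc[of _ x] True C0 by (intro drift_mono fin) (force simp: \<psi>_def R_def)
        then show ?thesis using ge p True eps by (auto split: split_indicator)
      next
        case large: False
        have "- C\<^sup>2 \<le> drift K (\<lambda>q. \<psi> (W q)) x"
        proof (cases "W x \<le> R")
          case True
          have "(W y)\<^sup>2 - (W x)\<^sup>2 \<le> \<psi> (W y) - \<psi> (W x) + C\<^sup>2" if y: "y \<in> set_pmf (K x)" for y
          proof (cases "W y \<le> R")
            case False
            then have "(W y - R)\<^sup>2 \<le> C\<^sup>2" using inc[OF y] True by (intro power_mono) auto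
            then show ?thesis using False True by (simp add: \<psi>_def power2_eq_square algebra_simps)
          qed (use True in \<open>simp add: \<psi>_def\<close>)
          from drift_mono_plus[where K=K and x=x and f="\<lambda>q. (W q)\<^sup>2" and g="\<lambda>q. \<psi> (W q)", OF fin this] show ?thesis using p eps by simp
        next
          case False
          \<comment> \<open>The factor \<open>\<rho>\<close> gives the square at \<open>W x\<close>
            the slope \<open>2 * R\<close> of the tangent; the increments then differ only by a
            quadratic term.\<close>
          define \<rho> where "\<rho> = R / W x"
          have \<rho>: "0 \<le> \<rho>" "\<rho> \<le> 1" "\<rho> * W x = R" using False R0 by (auto simp: \<rho>_def)
          have "\<rho> * (W y)\<^sup>2 - \<rho> * (W x)\<^sup>2 \<le> \<psi> (W y) - \<psi> (W x) + C\<^sup>2" if y: "y \<in> set_pmf (K x)" for y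
          proof -
            have "\<rho> * (W y)\<^sup>2 - \<rho> * (W x)\<^sup>2 = 2 * (\<rho> * W x) * (W y - W x) + \<rho> * (W y - W x)\<^sup>2"
              by (simp add: power2_eq_square algebra_simps)
            moreover have "\<rho> * (W y - W x)\<^sup>2 \<le> 1 * C\<^sup>2"
              using inc[OF y] \<rho> by (intro mult_mono) (auto simp: abs_le_square_iff[symmetric])
            moreover have "2 * R * (W y - W x) \<le> \<psi> (W y) - \<psi> (W x)"
              using False psi_ge[of "W y"] by (simp add: \<psi>_def algebra_simps)
            ultimately show ?thesis unfolding \<rho>(3) by linarith
          qed
          from drift_mono_plus[where K=K and x=x and f="\<lambda>q. \<rho> * (W q)\<^sup>2" and g="\<lambda>q. \<psi> (W q)", OF fin this]
          have "\<rho> * drift K (\<lambda>q. (W q)\<^sup>2) x \<le> drift K (\<lambda>q. \<psi> (W q)) x + C\<^sup>2"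
            unfolding drift_cmult .
          moreover have "0 \<le> \<rho> * drift K (\<lambda>q. (W q)\<^sup>2) x" using \<rho> p eps by simp
          ultimately show ?thesis by simp
        qed
        then show ?thesis using ge large n by (auto split: split_indicator)
      qed
    qed
    have "measure_pmf.expectation \<pi> (\<lambda>x. \<epsilon> * indicator {x0} x - C\<^sup>2 * indicator {x. real n < W x} x)
        \<le> measure_pmf.expectation \<pi> (drift K f)"
      by (intro integral_mono low st(1)) (simp add: measure_pmf.emeasure_eq_measure)
    then show ?thesis
      by (simp add: st(2) measure_pmf_single measure_pmf.emeasure_eq_measure)
  qed
  have "(\<lambda>n. measure_pmf.prob \<pi> {x. real n < W x}) \<longlonglongrightarrow> measure_pmf.prob \<pi> (\<Inter>n. {x. real n < W x})"
    by (intro measure_pmf.finite_Lim_measure_decseq) (auto simp: decseq_def)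
  moreover have "(\<Inter>n. {x. real n < W x}) = {}"
  proof -
    have "\<exists>n. \<not> real n < W x" for x
      using reals_Archimedean2[of "W x"] less_asym by auto
    then show ?thesis by auto
  qed
  ultimately have "(\<lambda>n. C\<^sup>2 * measure_pmf.prob \<pi> {x. real n < W x}) \<longlonglongrightarrow> C\<^sup>2 * 0"
    by (intro tendsto_mult_left) simp
  moreover have "eventually (\<lambda>n. \<epsilon> * pmf \<pi> x0 \<le> C\<^sup>2 * measure_pmf.prob \<pi> {x. real n < W x}) sequentially"
    using eventually_ge_at_top[of "nat \<lceil>W x0\<rceil>"] by eventually_elim (rule key, linarith)
  ultimately have "\<epsilon> * pmf \<pi> x0 \<le> C\<^sup>2 * 0"
    by (intro tendsto_lowerbound) auto
  then show False using eps x0 by (simp add: mult_le_0_iff pmf_le_0_iff set_pmf_iff)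
qed

text \<open>The function \<open>w + exp (- \<theta> w)\<close> is convex and, for
  \<open>w \<ge> 0\<close>, nondecreasing, so nonnegative drift is preserved. Of the gain from
  convexity only the transition to \<open>y\<close> is kept.\<close>

lemma drift_add_exp:
  assumes fin: "finite (set_pmf (K x))" and W: "0 \<le> W x" "0 \<le> drift K W x" and th: "0 \<le> \<theta>" "\<theta> \<le> 1"
  shows "exp (- \<theta> * W x) * (pmf (K x) y * (exp (- \<theta> * (W y - W x)) - 1 + \<theta> * (W y - W x)))
    \<le> drift K (\<lambda>q. W q + exp (- \<theta> * W q)) x"
proof -
  define e where "e = exp (- \<theta> * W x)"
  define h where "h y = exp (- \<theta> * (W y - W x)) - 1 + \<theta> * (W y - W x)" for y
  have h0: "0 \<le> h y" for y using exp_ge_add_one_self[of "- \<theta> * (W y - W x)"] by (simp add: h_def)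
  have e: "0 \<le> e" "e \<le> 1" using W th by (auto simp: e_def)
  then have "\<theta> * e \<le> 1" using th by (simp add: mult_le_one)
  have split: "exp (- \<theta> * W y) = e * exp (- \<theta> * (W y - W x))" for y
    by (simp add: e_def flip: exp_add) (simp add: algebra_simps)
  have int: "integrable (K x) g" for g :: "'a \<Rightarrow> real" by (rule integrable_measure_pmf_finite[OF fin])
  have "drift K (\<lambda>q. W q + exp (- \<theta> * W q)) x = measure_pmf.expectation (K x) (\<lambda>y. (1 - \<theta> * e) * (W y - W x) + e * h y)"
  proof -
    have "measure_pmf.expectation (K x) (\<lambda>q. W q + exp (- \<theta> * W q)) - (W x + e)
        = measure_pmf.expectation (K x) (\<lambda>q. (W q + exp (- \<theta> * W q)) - (W x + e))"
      by (subst Bochner_Integration.integral_diff) (simp_all add: int)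
    also have "\<dots> = measure_pmf.expectation (K x) (\<lambda>y. (1 - \<theta> * e) * (W y - W x) + e * h y)"
      unfolding split by (intro Bochner_Integration.integral_cong refl) (simp add: h_def algebra_simps)
    finally show ?thesis by (simp add: drift_def e_def)
  qed
  also have "\<dots> = (1 - \<theta> * e) * drift K W x + e * measure_pmf.expectation (K x) h"
    by (simp add: drift_def int)
  finally have "drift K (\<lambda>q. W q + exp (- \<theta> * W q)) x = (1 - \<theta> * e) * drift K W x + e * measure_pmf.expectation (K x) h" .
  moreover have "0 \<le> (1 - \<theta> * e) * drift K W x" using \<open>\<theta> * e \<le> 1\<close> W by simp
  moreover have "e * (pmf (K x) y * h y) \<le> e * measure_pmf.expectation (K x) h"
    using e h0 fin by (intro mult_left_mono expectation_ge_point) auto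
  ultimately show ?thesis
    unfolding e_def[symmetric] h_def[symmetric] by linarith
qed

section \<open>Instability outside the region\<close>

context aloha
begin

section \<open>The support of a stationary distribution\<close>

lemma pmf_step: "pmf (step q) z = drift step (indicator {z}) q + indicator {z} q"
  by (simp add: drift_def measure_pmf_single)

text \<open>The bound is the probability that both nodes are silent and both receive a packet,
  uniformly over the interior, the axes and the origin.\<close>

lemma pmf_step_up: "(1 - p1) * (1 - p2) * lam1 * lam2 \<le> pmf (step (x, y)) (Suc x, Suc y)"
proof -
  have "0 \<le> p1 * p2" "0 \<le> (1 - p1) * (1 - p2)" "0 \<le> lam1 * lam2"
    using p1 p2 lam1 lam2 by auto
  moreover have "1 - s1 - s2 = (1 - p1) * (1 - p2) + p1 * p2"
    by (simp add: s1_def s2_def algebra_simps)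
  moreover have "(1 - p1) * (1 - p2) \<le> 1 - p1" "(1 - p1) * (1 - p2) \<le> 1 - p2"
    "(1 - p1) * (1 - p2) \<le> 1"
    using p1 p2 by (auto intro: mult_left_le mult_left_le_one_le mult_le_one)
  ultimately have le: "(1 - p1) * (1 - p2) * (lam1 * lam2) \<le> c * (lam1 * lam2)"
    if "c \<in> {1 - s1 - s2, 1 - p1, 1 - p2, 1}" for c
    using that by (intro mult_right_mono) auto
  show ?thesis
    using le[of "1 - s1 - s2"] le[of "1 - p1"] le[of "1 - p2"] le[of 1]
    by (cases x; cases y) (simp_all add: pmf_step drift_step arrive_def mult.assoc)
qed

lemma pmf_step_down:
  assumes "lam1 < 1" "lam2 < 1"
  shows "0 < pmf (step (Suc x, y)) (x, y)" "0 < pmf (step (0, Suc y)) (0, y)"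
  using assms s1 s2 p1 p2
  by (cases y; simp add: pmf_step drift_step arrive_def)+

text \<open>The support is closed under transitions, and without arrivals queue 1 and then queue 2
  can be emptied.\<close>

lemma origin_in_support:
  assumes stat: "bind_pmf \<pi> step = \<pi>" and "lam1 < 1" "lam2 < 1"
  shows "(0, 0) \<in> set_pmf \<pi>"
proof -
  have down: "(x, y) \<in> set_pmf \<pi> \<Longrightarrow> (0, y) \<in> set_pmf \<pi>" "(0, y) \<in> set_pmf \<pi> \<Longrightarrow> (0, 0) \<in> set_pmf \<pi>" for x y
  proof (induction x)
    case (Suc x)
    {
      case 1
      then have "(x, y) \<in> set_pmf \<pi>"
        using set_stationary[OF stat] pmf_step_down(1)[OF assms(2,3)] by (meson pmf_positive_iff)
      with Suc.IH(1) show ?case .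
    }
    {
      case 2
      with Suc.IH(2) show ?case .
    }
  next
    case 0
    {
      case 2
      then show ?case
      proof (induction y)
        case (Suc y)
        then show ?case
          using set_stationary[OF stat] pmf_step_down(2)[OF assms(2,3)] by (meson pmf_positive_iff)
      qed
    }
  qed
  obtain x y where "(x, y) \<in> set_pmf \<pi>" using set_pmf_not_empty[of \<pi>] by auto
  then show ?thesis using down by blast
qed

text \<open>These states of positive mass have arbitrarily long queues, which contradicts upper
  bounds for unbounded test functions on the support.\<close>

lemma diagonal_in_support:
  assumes stat: "bind_pmf \<pi> step = \<pi>" and "0 < lam1" "lam1 < 1" "0 < lam2" "lam2 < 1"
  shows "(n, n) \<in> set_pmf \<pi>"
proof (induction n)
  case 0
  then show ?case using origin_in_support assms by auto
next
  case (Suc n)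
  have "0 < (1 - p1) * (1 - p2) * lam1 * lam2" using p1 p2 assms by simp
  then have "0 < pmf (step (n, n)) (Suc n, Suc n)" using pmf_step_up[of n n] by linarith
  then show ?case using set_stationary[OF stat Suc] by (simp add: pmf_positive_iff)
qed

text \<open>In the interior \<open>z ^ x\<close> is harmonic at
  \<open>z = s1 (1 - lam1) / (lam1 (1 - s1))\<close>. If \<open>lam1 > s1\<close>, then for
  \<open>z\<close> between this value and 1 the drift of \<open>- z ^ x\<close> is positive there
  and on \<open>x = 0\<close>.\<close>

lemma drift_geometric:
  fixes z :: real
  shows "drift step (\<lambda>(x, y). z ^ x) (Suc x, Suc y) = - (z ^ x * (1 - z) * (lam1 * (1 - s1) * z - s1 * (1 - lam1)))"
    and "drift step (\<lambda>(x, y). z ^ x) (Suc x, 0) = - (z ^ x * (1 - z) * (lam1 * (1 - p1) * z - p1 * (1 - lam1)))"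
    and "drift step (\<lambda>(x, y). z ^ x) (0, y) = - (lam1 * (1 - z))"
    apply (simp add: drift_step arrive_def algebra_simps)
   apply (simp add: drift_step arrive_def algebra_simps)
  apply (cases y; simp add: drift_step arrive_def algebra_simps)
  done

text \<open>Only queue 1 is overloaded. On the border itself the linear \<open>W\<close> has zero
  drift wherever \<open>x > 0\<close>, so strict positivity must come from a convex
  correction.\<close>

lemma not_stationary_strip:
  assumes l2: "0 < lam2" "lam2 < s2" and l1: "p1 * (1 - lam2 / (1 - p1)) \<le> lam1" "lam1 < p1"
  shows "bind_pmf \<pi> step \<noteq> \<pi>"
proof
  assume stat: "bind_pmf \<pi> step = \<pi>"
  have ge: "0 \<le> p1 * lam2 - (1 - p1) * (p1 - lam1)"
    using l1 p1 by (simp add: field_simps)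
  have "lam2 < 1" "lam1 < 1" using l1 l2 p1 p2 s2 by auto
  have "s1 < lam1"
  proof -
    have "p1 * lam2 < p1 * s2" using l2 p1 by simp
    then have "0 < (1 - p1) * (lam1 - s1)"
      using ge by (simp add: s1_def s2_def algebra_simps)
    then show ?thesis using p1 by (simp add: zero_less_mult_iff)
  qed
  then have "0 < lam1" using s1 by simp
  have "0 < lam1 * (1 - s1) - s1 * (1 - lam1)" using \<open>s1 < lam1\<close> by (simp add: algebra_simps)
  then have "s1 * (1 - lam1) / (lam1 * (1 - s1)) < 1"
    using \<open>0 < lam1\<close> s1 p1 by (simp add: divide_less_eq_1)
  \<comment> \<open>The bound \<open>1 / 2\<close> yields \<open>\<theta> \<le> 1\<close>
    below.\<close>
  then obtain z where z: "s1 * (1 - lam1) / (lam1 * (1 - s1)) < z" "1 / 2 < z" "z < 1"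
    using dense[of "max (s1 * (1 - lam1) / (lam1 * (1 - s1))) (1 / 2)" 1] by auto
  have z0: "s1 * (1 - lam1) \<le> lam1 * (1 - s1) * z"
    using z(1) \<open>0 < lam1\<close> s1 p1 by (simp add: field_simps)
  \<comment> \<open>With \<open>exp (- \<theta>) = \<tau> > z\<close> the convex term decays more
    slowly than \<open>z ^ x\<close>.\<close>
  obtain \<tau> where \<tau>: "z < \<tau>" "\<tau> < 1" using dense[of z 1] z by blast
  define \<theta> where "\<theta> = - ln \<tau>"
  have exp_th: "exp (- \<theta>) = \<tau>" using z \<tau> by (simp add: \<theta>_def)
  have \<theta>: "0 < \<theta>" "\<theta> \<le> 1"
  proof -
    show "0 < \<theta>" using z \<tau> by (simp add: \<theta>_def ln_less_zero)
    have "\<theta> \<le> 1 / \<tau> - 1"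
      using ln_le_minus_one[of "1 / \<tau>"] z \<tau> by (simp add: \<theta>_def ln_div)
    also have "1 / \<tau> \<le> 2" using z \<tau> by (simp add: field_simps)
    finally show "\<theta> \<le> 1" by simp
  qed
  \<comment> \<open>This slope makes the drift of \<open>W\<close> vanish on the axis
    \<open>y = 0\<close>.\<close>
  define r where "r = (p1 - lam1) / lam2"
  have r: "0 < r" "r * lam2 = p1 - lam1" using l1 l2 by (auto simp: r_def)
  define W :: "nat \<times> nat \<Rightarrow> real" where "W = (\<lambda>(x, y). 1 * real x + r * real y)"
  have W0: "0 \<le> W q" for q using r by (auto simp: W_def split: prod.split)
  have driftW: "0 \<le> drift step W (Suc x, y)" "- (r * p2) \<le> drift step W (0, y)" for x y
  proof -
    have "lam2 * ((lam1 - s1) + r * (lam2 - s2)) = lam2 * (lam1 - s1) - (p1 - lam1) * (s2 - lam2)"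
      unfolding r(2)[symmetric] by (simp add: algebra_simps)
    also have "\<dots> = p2 * (p1 * lam2 - (1 - p1) * (p1 - lam1))"
      by (simp add: s1_def s2_def algebra_simps)
    finally have "0 \<le> lam2 * ((lam1 - s1) + r * (lam2 - s2))" using ge p2 by simp
    then have "0 \<le> (lam1 - s1) + r * (lam2 - s2)" using l2 by (simp add: zero_le_mult_iff)
    then show "0 \<le> drift step W (Suc x, y)" unfolding W_def drift_linear using r by auto
    have "0 \<le> r * lam2" "0 \<le> r * p2" using r l1 l2 p2 by simp_all
    then show "- (r * p2) \<le> drift step W (0, y)"
      unfolding W_def drift_linear using lam1 by (auto simp: right_diff_distrib)
  qed
  \<comment> \<open>The drift of \<open>W\<close> can be negative only on \<open>{x = 0}\<close>, where \<open>- M z\<^sup>x\<close> compensates. Its price on the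
    other axis is of order \<open>z\<^sup>x\<close>, and the convex term \<open>exp (- \<theta> W)\<close>, which decays more slowly, pays for
    it except at finitely many states.\<close>
  define M where "M = (r * p2 + 2) / (lam1 * (1 - z))"
  have M: "0 < M" "M * (lam1 * (1 - z)) = r * p2 + 2"
    using r p2 \<open>0 < lam1\<close> z by (auto simp: M_def add_pos_pos)
  define c where "c = (1 - p1) * (1 - p2) * lam1 * lam2 * (exp (- \<theta> * (1 + r)) - 1 + \<theta> * (1 + r))"
  have c: "0 < c"
  proof -
    have "0 < exp (- \<theta> * (1 + r)) - 1 + \<theta> * (1 + r)"
      using exp_minus_greater[of "\<theta> * (1 + r)"] \<theta> r by simp
    then show ?thesis using p1 p2 \<open>0 < lam1\<close> l2 by (simp add: c_def)
  qed
  define f1 where "f1 = (\<lambda>q. W q + exp (- \<theta> * W q))"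
  define f where "f = (\<lambda>q. f1 q - M * (case q of (x, y) \<Rightarrow> z ^ x))"
  have driftf: "drift step f q = drift step f1 q - M * drift step (\<lambda>(x, y). z ^ x) q" for q
    unfolding f_def by (rule drift_diff) simp
  have drift1: "exp (- \<theta> * W (Suc x, y)) * c \<le> drift step f1 (Suc x, y)" for x y
  proof -
    have "W (Suc (Suc x), Suc y) - W (Suc x, y) = 1 + r" by (simp add: W_def algebra_simps)
    moreover have "0 \<le> exp (- \<theta> * (1 + r)) - 1 + \<theta> * (1 + r)"
      using exp_ge_add_one_self[of "- \<theta> * (1 + r)"] by simp
    then have "c \<le> pmf (step (Suc x, y)) (Suc (Suc x), Suc y) * (exp (- \<theta> * (1 + r)) - 1 + \<theta> * (1 + r))"
      unfolding c_def by (intro mult_right_mono pmf_step_up)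
    ultimately have "exp (- \<theta> * W (Suc x, y)) * c \<le> exp (- \<theta> * W (Suc x, y)) *
        (pmf (step (Suc x, y)) (Suc (Suc x), Suc y) *
          (exp (- \<theta> * (W (Suc (Suc x), Suc y) - W (Suc x, y))) - 1 + \<theta> * (W (Suc (Suc x), Suc y) - W (Suc x, y))))"
      by simp
    also have "\<dots> \<le> drift step f1 (Suc x, y)"
      unfolding f1_def using W0 driftW \<theta> by (intro drift_add_exp) auto
    finally show ?thesis .
  qed
  have f1_W: "W q \<le> f1 q" "f1 q \<le> W q + 1" for q
    using W0[of q] \<theta> by (auto simp: f1_def)
  have "(\<lambda>n. (z / \<tau>) ^ n) \<longlonglongrightarrow> 0"
    using z \<tau> by (intro LIMSEQ_realpow_zero) auto
  then have "eventually (\<lambda>n. (z / \<tau>) ^ n < c * \<tau> / M) sequentially"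
    using c z \<tau> M by (intro order_tendstoD(2)[where y=0]) auto
  then obtain N where N: "\<And>n. n \<ge> N \<Longrightarrow> (z / \<tau>) ^ n < c * \<tau> / M"
    by (auto simp: eventually_sequentially)
  \<comment> \<open>On \<open>y = 0\<close> with \<open>x > 0\<close> the function \<open>f\<close>
    is at most \<open>x + 1\<close>, so the threshold \<open>N + 2\<close> removes the states there
    at which the geometric price is not yet covered.\<close>
  have pos: "0 < drift step f q" if q: "real N + 2 < f q" for q
  proof -
    obtain x y where xy: "q = (x, y)" by fastforce
    show ?thesis
    proof (cases x)
      case 0
      \<comment> \<open>The convex term loses at most 1 and \<open>W\<close> at most
        \<open>r * p2\<close>; the gain \<open>r * p2 + 2\<close> from \<open>M\<close> leaves at
        least 1.\<close>
      have "drift step W q + (- 1) \<le> drift step f1 q"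
      proof -
        have "drift step W q \<le> drift step f1 q + 1"
          using W0 \<theta> by (intro drift_mono_plus) (auto simp: f1_def add_increasing)
        then show ?thesis by simp
      qed
      moreover have "drift step f q = drift step f1 q + M * (lam1 * (1 - z))"
        unfolding driftf xy 0 drift_geometric by simp
      ultimately show ?thesis using driftW(2)[of y] M xy 0 by simp
    next
      case (Suc n)
      have e: "0 < exp (- \<theta> * W q) * c" using c by simp
      have d1: "exp (- \<theta> * W q) * c \<le> drift step f1 q" using drift1[of n y] xy Suc by simp
      show ?thesis
      proof (cases y)
        case (Suc m)
        have "drift step (\<lambda>(x, y). z ^ x) q \<le> 0"
          unfolding xy \<open>x = Suc n\<close> Suc drift_geometric
          using z z0 by (simp add: mult.commute)
        then have "M * drift step (\<lambda>(x, y). z ^ x) q \<le> 0"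
          using M by (simp add: mult_le_0_iff)
        then show ?thesis using d1 e unfolding driftf by linarith
      next
        case 0
        have "f q \<le> real n + 2"
        proof -
          have "0 \<le> M * z ^ x" using M z by simp
          then have "f q \<le> f1 q" by (simp add: f_def xy)
          also have "\<dots> \<le> W q + 1" by (rule f1_W)
          finally show ?thesis by (simp add: xy Suc 0 W_def)
        qed
        then have "N \<le> n" using q by simp
        have "drift step (\<lambda>(x, y). z ^ x) q \<le> z ^ n * 1"
        proof -
          have "p1 * (1 - lam1) \<le> 1" "0 \<le> lam1 * (1 - p1) * z"
            using p1 lam1 z by (auto intro: mult_le_one)
          then have "(1 - z) * (p1 * (1 - lam1) - lam1 * (1 - p1) * z) \<le> (1 - z) * 1"
            using z by (intro mult_left_mono) auto
          then have "(1 - z) * (p1 * (1 - lam1) - lam1 * (1 - p1) * z) \<le> 1"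
            by (rule order_trans) (use z in simp)
          then have "z ^ n * ((1 - z) * (p1 * (1 - lam1) - lam1 * (1 - p1) * z)) \<le> z ^ n * 1"
            using z by (intro mult_left_mono) auto
          then show ?thesis unfolding xy Suc 0 drift_geometric by (simp add: algebra_simps)
        qed
        then have "M * drift step (\<lambda>(x, y). z ^ x) q \<le> M * z ^ n" using M by simp
        also have "\<dots> < c * \<tau> * \<tau> ^ n"
          using N[OF \<open>N \<le> n\<close>] M z \<tau> by (simp add: power_divide field_simps)
        also have "c * \<tau> * \<tau> ^ n = exp (- \<theta> * W q) * c"
        proof -
          have "exp (- \<theta> * W q) = exp (real (Suc n) * - \<theta>)"
            by (simp add: xy Suc 0 W_def mult.commute)
          also have "\<dots> = exp (- \<theta>) ^ Suc n" by (rule exp_of_nat_mult)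
          finally have "exp (- \<theta> * W q) = exp (- \<theta>) ^ Suc n" .
          then show ?thesis by (simp add: exp_th)
        qed
        finally show ?thesis using d1 unfolding driftf by linarith
      qed
    qed
  qed
  have inc: "\<bar>f q' - f q\<bar> \<le> (1 + r) + 1 + M" if "q' \<in> set_pmf (step q)" for q q'
  proof -
    have "\<bar>W q' - W q\<bar> \<le> 1 + r"
    proof -
      have "W q' - W q = (real (fst q') - real (fst q)) + r * (real (snd q') - real (snd q))"
        by (simp add: W_def split_beta algebra_simps)
      also have "\<bar>\<dots>\<bar> \<le> 1 + r * 1"
        using set_step[OF that] r by (intro order_trans[OF abs_triangle_ineq] add_mono) (auto simp: abs_mult)
      finally show ?thesis by simp
    qed
    moreover have "\<bar>exp (- \<theta> * W q') - exp (- \<theta> * W q)\<bar> \<le> 1"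
    proof -
      have "0 \<le> exp (- \<theta> * W a)" "exp (- \<theta> * W a) \<le> 1" for a using W0[of a] \<theta> by auto
      from this[of q] this[of q'] show ?thesis by linarith
    qed
    moreover have "\<bar>M * z ^ fst q' - M * z ^ fst q\<bar> \<le> M * 1"
    proof -
      have "z ^ k \<in> {0..1}" for k using z by (auto intro: power_le_one)
      from this[of "fst q"] this[of "fst q'"] have "\<bar>z ^ fst q' - z ^ fst q\<bar> \<le> 1" by auto
      then have "M * \<bar>z ^ fst q' - z ^ fst q\<bar> \<le> M * 1" using M by (intro mult_left_mono) auto
      then show ?thesis using M by (simp add: abs_mult flip: right_diff_distrib)
    qed
    ultimately show ?thesis by (simp add: f_def f1_def split_beta)
  qed
  obtain n where n: "real N + 2 + M < real n" using reals_Archimedean2 by blast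
  have "f (n, n) \<le> real N + 2"
    using stationary_subharmonic_bound[OF stat finite_set_step inc pos]
      diagonal_in_support[OF stat] \<open>0 < lam1\<close> \<open>lam1 < 1\<close> l2 \<open>lam2 < 1\<close> by blast
  moreover have "real n - M \<le> f (n, n)"
  proof -
    have "M * z ^ n \<le> M * 1" using M z by (intro mult_left_mono power_le_one) auto
    moreover have "real n \<le> W (n, n)" using r by (simp add: W_def)
    ultimately show ?thesis using f1_W(1)[of "(n, n)"] by (simp add: f_def)
  qed
  ultimately show False using n by linarith
qed

text \<open>At the rates \<open>(s1, s2)\<close> every linear function has zero drift in the
  interior, so the quadratic form needs a positive constant term there, and positive linear terms on
  the axes.\<close>

lemma not_stationary_corner:
  assumes l1: "s1 \<le> lam1" "lam1 < p1" and l2: "s2 \<le> lam2" "lam2 < p2"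
  shows "bind_pmf \<pi> step \<noteq> \<pi>"
proof
  assume stat: "bind_pmf \<pi> step = \<pi>"
  have s1_lt: "s1 < 1" and s2_lt: "s2 < 1" using s1 s2 p1 p2 by auto
  define u where "u = 2 - p1 - p2"
  have u: "0 < u" using p1 p2 by (simp add: u_def)
  \<comment> \<open>At the rates \<open>(s1, s2)\<close> the axes require \<open>t < 1\<close> and
    the constant term \<open>t * (2 * p1 * p2 + u) > 2 * p1 * p2\<close>; this is the midpoint of
    the admissible interval.\<close>
  define t where "t = (2 * p1 * p2 + u / 2) / (2 * p1 * p2 + u)"
  have t: "0 < t" "t < 1" "t * (2 * p1 * p2 + u) = 2 * p1 * p2 + u / 2"
  proof -
    have "0 < 2 * p1 * p2" using p1 p2 by simp
    then have "0 < 2 * p1 * p2 + u" "0 < 2 * p1 * p2 + u / 2" using u by linarith+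
    then show "0 < t" "t < 1" "t * (2 * p1 * p2 + u) = 2 * p1 * p2 + u / 2"
      using u by (simp_all add: t_def)
  qed
  \<comment> \<open>With \<open>t = 1\<close> the linear drift terms vanish on both axes at \<open>\<lambda> = (s1, s2)\<close>.\<close>
  define a c where "a = t * (1 - p1) / p1" and "c = t * (1 - p2) / p2"
  have ac: "0 < a" "0 < c" using t p1 p2 by (auto simp: a_def c_def)
  define V :: "nat \<times> nat \<Rightarrow> real" where
    "V = (\<lambda>(x, y). a * (real x)\<^sup>2 + 2 * 1 * real x * real y + c * (real y)\<^sup>2)"
  define ci where "ci = a * (lam1 + s1 - 2 * lam1 * s1) + c * (lam2 + s2 - 2 * lam2 * s2)
    + 2 * 1 * ((lam1 - s1) * (lam2 - s2) - s1 * s2)"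
  have ci: "0 < ci"
  proof -
    have "s1 * (1 - s1) \<le> lam1 + s1 - 2 * lam1 * s1"
    proof -
      have "lam1 + s1 - 2 * lam1 * s1 - s1 * (1 - s1) = (lam1 - s1) * (1 - s1) + s1 * (1 - lam1)"
        by (simp add: algebra_simps)
      moreover have "0 \<le> (lam1 - s1) * (1 - s1)" "0 \<le> s1 * (1 - lam1)"
        using l1 s1_lt s1 lam1 by simp_all
      ultimately show ?thesis by linarith
    qed
    then have A: "a * (s1 * (1 - s1)) \<le> a * (lam1 + s1 - 2 * lam1 * s1)" using ac by simp
    have "s2 * (1 - s2) \<le> lam2 + s2 - 2 * lam2 * s2"
    proof -
      have "lam2 + s2 - 2 * lam2 * s2 - s2 * (1 - s2) = (lam2 - s2) * (1 - s2) + s2 * (1 - lam2)"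
        by (simp add: algebra_simps)
      moreover have "0 \<le> (lam2 - s2) * (1 - s2)" "0 \<le> s2 * (1 - lam2)"
        using l2 s2_lt s2 lam2 by simp_all
      ultimately show ?thesis by linarith
    qed
    then have C: "c * (s2 * (1 - s2)) \<le> c * (lam2 + s2 - 2 * lam2 * s2)" using ac by simp
    have "a * (s1 * (1 - s1)) + c * (s2 * (1 - s2)) = (1 - p1) * (1 - p2) * (t * (2 * p1 * p2 + u))"
      using p1 p2 by (simp add: a_def c_def s1_def s2_def u_def field_simps)
    also have "\<dots> = 2 * (s1 * s2) + (1 - p1) * (1 - p2) * (u / 2)"
      unfolding t(3) by (simp add: s1_def s2_def algebra_simps)
    finally have "2 * (s1 * s2) < a * (s1 * (1 - s1)) + c * (s2 * (1 - s2))"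
      using u p1 p2 by simp
    moreover have "0 \<le> (lam1 - s1) * (lam2 - s2)" using l1 l2 by simp
    ultimately show ?thesis using A C unfolding ci_def by argo
  qed
  have xa: "0 < a * (lam1 - p1) + 1 * lam2"
  proof -
    have "p1 - lam1 \<le> p1 * p2" using l1 by (simp add: s1_def algebra_simps)
    then have "a * (p1 - lam1) \<le> a * (p1 * p2)" using ac by (intro mult_left_mono) auto
    also have "\<dots> = t * s2" using p1 by (simp add: a_def s2_def)
    also have "\<dots> < s2" using t s2 by simp
    finally show ?thesis using l2 by (simp add: algebra_simps)
  qed
  have ya: "0 < 1 * lam1 + c * (lam2 - p2)"
  proof -
    have "p2 - lam2 \<le> p1 * p2" using l2 by (simp add: s2_def algebra_simps)
    then have "c * (p2 - lam2) \<le> c * (p1 * p2)" using ac by (intro mult_left_mono) auto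
    also have "\<dots> = t * s1" using p2 by (simp add: c_def s1_def)
    also have "\<dots> < s1" using t s1 by simp
    finally show ?thesis using l1 by (simp add: algebra_simps)
  qed
  note dq = drift_quadratic[where a=a and b=1 and c=c, folded V_def ci_def]
  define xc yc where "xc = a * (lam1 + p1 - 2 * lam1 * p1) + 2 * 1 * lam2 * (lam1 - p1) + c * lam2"
    and "yc = a * lam1 + 2 * 1 * lam1 * (lam2 - p2) + c * (lam2 + p2 - 2 * lam2 * p2)"
  have far: "\<exists>N. \<forall>n\<ge>N. 1 \<le> 2 * real n * i + j" if "0 < i" for i j :: real
  proof -
    have "1 \<le> 2 * real n * i + j" if n: "n \<ge> nat \<lceil>(1 - j) / (2 * i)\<rceil>" for n
    proof -
      have "(1 - j) / (2 * i) \<le> real n" using n by linarith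
      then show ?thesis using \<open>0 < i\<close> by (simp add: field_simps)
    qed
    then show ?thesis by blast
  qed
  obtain N where N: "\<And>n. n \<ge> N \<Longrightarrow> 1 \<le> 2 * real n * (a * (lam1 - p1) + 1 * lam2) + xc"
    using far[OF xa] by blast
  obtain N' where N': "\<And>n. n \<ge> N' \<Longrightarrow> 1 \<le> 2 * real n * (1 * lam1 + c * (lam2 - p2)) + yc"
    using far[OF ya] by blast
  \<comment> \<open>Being above \<open>k\<close> excludes the origin and leaves on the axes only
    states from \<open>N\<close> or \<open>N'\<close> on; in the interior the drift is at least
    \<open>ci\<close> anyway.\<close>
  define k where "k = a * (real N)\<^sup>2 + c * (real N')\<^sup>2"
  have pos: "min ci 1 \<le> drift step V q" if q: "k < V q" for q
  proof -
    obtain x y where xy: "q = (x, y)" by fastforce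
    have k0: "0 \<le> a * (real N)\<^sup>2" "0 \<le> c * (real N')\<^sup>2" using ac by simp_all
    consider "x > 0" "y > 0" | "x > 0" "y = 0" | "x = 0" "y > 0" | "x = 0" "y = 0" by blast
    then show ?thesis
    proof cases
      case 1
      have "0 \<le> 2 * real x * (a * (lam1 - s1) + 1 * (lam2 - s2))" "0 \<le> 2 * real y * (1 * (lam1 - s1) + c * (lam2 - s2))"
        using l1 l2 ac by simp_all
      then show ?thesis using dq(1)[OF 1] xy by simp
    next
      case 2
      then have "a * (real N)\<^sup>2 \<le> a * (real x)\<^sup>2" using q xy k0 unfolding k_def V_def by simp
      then have "N \<le> x" using ac by (simp add: power2_le_iff_abs_le)
      then show ?thesis using dq(2)[OF 2(1), folded xc_def] N[of x] xy 2 by simp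
    next
      case 3
      then have "c * (real N')\<^sup>2 \<le> c * (real y)\<^sup>2" using q xy k0 unfolding k_def V_def by simp
      then have "N' \<le> y" using ac by (simp add: power2_le_iff_abs_le)
      then show ?thesis using dq(3)[OF 3(2), folded yc_def] N'[of y] xy 3 by simp
    next
      case 4
      then show ?thesis using q xy k0 unfolding k_def V_def by simp
    qed
  qed
  have V0: "0 \<le> V q" for q using ac by (auto simp: V_def split: prod.split)
  \<comment> \<open>\<open>V\<close> has unbounded increments, but its square root has bounded ones:
    \<open>C\<close> is such that raising both coordinates by one takes \<open>V\<close> to at most
    \<open>(W + C)^2\<close>.\<close>
  define W where "W q = sqrt (V q)" for q
  define C where "C = (a + 1) / sqrt a + (c + 1) / sqrt c + sqrt (a + 2 + c)"
  have C0: "0 \<le> (a + 1) / sqrt a" "0 \<le> (c + 1) / sqrt c" "0 \<le> sqrt (a + 2 + c)" using ac by simp_all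
  have grow: "W (x', y') \<le> W (x, y) + C" if le: "real x' \<le> real x + 1" "real y' \<le> real y + 1" for x y x' y'
  proof -
    have Wx: "sqrt a * real x \<le> W (x, y)" and Wy: "sqrt c * real y \<le> W (x, y)"
      using ac unfolding W_def V_def by (auto intro!: real_le_rsqrt simp: power_mult_distrib)
    have "(a + 1) * real x \<le> (a + 1) / sqrt a * W (x, y)" "(c + 1) * real y \<le> (c + 1) / sqrt c * W (x, y)"
      using mult_left_mono[OF Wx C0(1)] mult_left_mono[OF Wy C0(2)] ac by simp_all
    moreover have "0 \<le> sqrt (a + 2 + c) * W (x, y)"
      using C0(3) V0 by (simp add: W_def)
    moreover have "C * W (x, y) = (a + 1) / sqrt a * W (x, y) + (c + 1) / sqrt c * W (x, y) + sqrt (a + 2 + c) * W (x, y)"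
      by (simp only: C_def distrib_right)
    ultimately have lin: "(a + 1) * real x + (c + 1) * real y \<le> C * W (x, y)" by linarith
    have "a + 2 + c = (sqrt (a + 2 + c))\<^sup>2" using ac by simp
    also have "\<dots> \<le> C\<^sup>2" using C0 by (intro power_mono) (auto simp: C_def)
    finally have const: "a + 2 + c \<le> C\<^sup>2" .
    have "V (x', y') \<le> a * (real x + 1)\<^sup>2 + 2 * 1 * (real x + 1) * (real y + 1) + c * (real y + 1)\<^sup>2"
      unfolding V_def prod.case using le ac by (intro add_mono mult_mono power_mono) auto
    also have "\<dots> = V (x, y) + 2 * ((a + 1) * real x + (c + 1) * real y) + (a + 2 + c)"
      by (simp add: V_def power2_eq_square algebra_simps)
    also have "\<dots> \<le> V (x, y) + 2 * (C * W (x, y)) + C\<^sup>2"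
      using lin const by (intro add_mono mult_left_mono order_refl) auto
    also have "V (x, y) = (W (x, y))\<^sup>2" using V0 by (simp add: W_def)
    also have "(W (x, y))\<^sup>2 + 2 * (C * W (x, y)) + C\<^sup>2 = (W (x, y) + C)\<^sup>2"
      by (simp add: power2_eq_square algebra_simps)
    finally show ?thesis
      unfolding W_def[of "(x', y')"] using V0 C0 by (intro real_le_lsqrt) (auto simp: W_def C_def)
  qed
  have W2: "(\<lambda>q. (W q)\<^sup>2) = V" using V0 by (auto simp: W_def)
  have "\<bar>W y - W x\<bar> \<le> C" if "y \<in> set_pmf (step x)" for x y
    using set_step[OF that] grow[of "fst y" "fst x" "snd y" "snd x"] grow[of "fst x" "fst y" "snd x" "snd y"]
    by (auto simp: abs_le_iff)
  moreover have "min ci 1 \<le> drift step (\<lambda>q. (W q)\<^sup>2) q" if "k < (W q)\<^sup>2" for q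
    using pos[of q] that unfolding W2 using fun_cong[OF W2, of q] by simp
  moreover have "lam1 < 1" "lam2 < 1" "0 < lam1" "0 < lam2" using l1 l2 p1 p2 s1 s2 by auto
  ultimately have "(W (n, n))\<^sup>2 \<le> k" for n
    using stationary_square_drift_bound[OF stat finite_set_step, of W C "min ci 1" k "(n, n)"]
      diagonal_in_support[OF stat] V0 ci by (auto simp: W_def)
  moreover obtain n where "\<bar>k\<bar> + 1 < real n" using reals_Archimedean2 by blast
  moreover have "real n \<le> (W (n, n))\<^sup>2" if "1 < real n"
  proof -
    have "real n * 1 \<le> real n * real n" using that by (intro mult_left_mono) auto
    moreover have "0 \<le> a * (real n * real n)" "0 \<le> c * (real n * real n)" using ac by simp_all
    ultimately show ?thesis using fun_cong[OF W2, of "(n, n)"] by (simp add: V_def power2_eq_square)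
  qed
  ultimately show False by (smt (verit))
qed

end

section \<open>The stability region\<close>

lemma aloha_step_swap:
  "aloha_step lam2 p2 lam1 p1 (prod.swap q) = map_pmf prod.swap (aloha_step lam1 p1 lam2 p2 q)"
proof -
  obtain x y where q: "q = (x, y)" by fastforce
  have "aloha_step lam2 p2 lam1 p1 (y, x) =
      bernoulli_pmf (p2 * of_bool (y > 0)) \<bind> (\<lambda>t2. bernoulli_pmf (p1 * of_bool (x > 0)) \<bind> (\<lambda>t1.
        bernoulli_pmf lam2 \<bind> (\<lambda>a2. bernoulli_pmf lam1 \<bind> (\<lambda>a1.
          return_pmf (y - of_bool (t2 \<and> \<not> t1) + of_bool a2, x - of_bool (t1 \<and> \<not> t2) + of_bool a1)))))"
    by (simp add: aloha_step_def departures_def bind_assoc_pmf bind_return_pmf)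
  also have "\<dots> = bernoulli_pmf (p1 * of_bool (x > 0)) \<bind> (\<lambda>t1. bernoulli_pmf (p2 * of_bool (y > 0)) \<bind> (\<lambda>t2.
        bernoulli_pmf lam2 \<bind> (\<lambda>a2. bernoulli_pmf lam1 \<bind> (\<lambda>a1.
          return_pmf (y - of_bool (t2 \<and> \<not> t1) + of_bool a2, x - of_bool (t1 \<and> \<not> t2) + of_bool a1)))))"
    by (rule bind_commute_pmf)
  also have "\<dots> = bernoulli_pmf (p1 * of_bool (x > 0)) \<bind> (\<lambda>t1. bernoulli_pmf (p2 * of_bool (y > 0)) \<bind> (\<lambda>t2.
        bernoulli_pmf lam1 \<bind> (\<lambda>a1. bernoulli_pmf lam2 \<bind> (\<lambda>a2.
          return_pmf (y - of_bool (t2 \<and> \<not> t1) + of_bool a2, x - of_bool (t1 \<and> \<not> t2) + of_bool a1)))))"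
    by (intro bind_pmf_cong refl bind_commute_pmf)
  also have "\<dots> = map_pmf prod.swap (aloha_step lam1 p1 lam2 p2 (x, y))"
    by (simp add: aloha_step_def departures_def bind_assoc_pmf bind_return_pmf map_bind_pmf)
  finally show ?thesis by (simp add: q)
qed

lemma aloha_stationary_swap:
  assumes "bind_pmf \<pi> (aloha_step lam1 p1 lam2 p2) = \<pi>"
  shows "bind_pmf (map_pmf prod.swap \<pi>) (aloha_step lam2 p2 lam1 p1) = map_pmf prod.swap \<pi>"
proof -
  have "bind_pmf (map_pmf prod.swap \<pi>) (aloha_step lam2 p2 lam1 p1) =
      map_pmf prod.swap (bind_pmf \<pi> (aloha_step lam1 p1 lam2 p2))"
    by (simp add: bind_map_pmf map_bind_pmf aloha_step_swap)
  then show ?thesis using assms by simp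
qed

context aloha
begin

text \<open>Rate balance gives the weak inequalities. They make slots without arrivals possible, so
  the origin has positive mass, which makes the inequalities strict.\<close>

lemma stationary_lt:
  assumes stat: "bind_pmf \<pi> step = \<pi>"
  shows "lam1 < p1" "lam2 < p2"
proof -
  obtain a b c where abc: "0 \<le> a" "0 \<le> b" "0 \<le> c" "a + b + c + pmf \<pi> (0, 0) = 1"
    "lam1 = s1 * a + p1 * b" "lam2 = s2 * a + p2 * c"
    using stationary_rates[OF stat] by blast
  have le: "lam1 \<le> p1 * (a + b)" "lam2 \<le> p2 * (a + c)"
    using abc s1 s2 by (simp_all add: distrib_left mult_right_mono)
  have "a + b \<le> 1 - pmf \<pi> (0, 0)" "a + c \<le> 1 - pmf \<pi> (0, 0)" using abc by auto
  then have le': "lam1 \<le> p1 * (1 - pmf \<pi> (0, 0))" "lam2 \<le> p2 * (1 - pmf \<pi> (0, 0))"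
    using le p1 p2 by (meson mult_left_mono order_trans less_imp_le)+
  have "p1 * (1 - pmf \<pi> (0, 0)) \<le> p1" "p2 * (1 - pmf \<pi> (0, 0)) \<le> p2"
    using p1 p2 by (simp_all add: mult_left_le pmf_nonneg)
  then have "lam1 \<le> p1" "lam2 \<le> p2" using le' by linarith+
  then have "(0, 0) \<in> set_pmf \<pi>" using p1 p2 by (intro origin_in_support stat) auto
  then have "0 < pmf \<pi> (0, 0)" by (simp add: pmf_positive_iff)
  then have "p1 * (1 - pmf \<pi> (0, 0)) < p1" "p2 * (1 - pmf \<pi> (0, 0)) < p2"
    using p1 p2 by simp_all
  then show "lam1 < p1" "lam2 < p2" using le' by auto
qed

text \<open>Each disjunct names a queue that stays stable when the other node is saturated;
  exchanging the nodes exchanges the disjuncts.\<close>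

theorem stable_region:
  "aloha_stable lam1 p1 lam2 p2 \<longleftrightarrow>
    lam2 < s2 \<and> lam1 < p1 * (1 - lam2 / (1 - p1)) \<or> lam1 < s1 \<and> lam2 < p2 * (1 - lam1 / (1 - p2))"
proof -
  interpret sw: aloha lam2 p2 lam1 p1
    using p1 p2 lam1 lam2 by unfold_locales
  have sw: "sw.s1 = s2" "sw.s2 = s1" by (simp_all add: s1_def s2_def sw.s1_def sw.s2_def)
  have swap: "(\<exists>\<pi>. bind_pmf \<pi> sw.step = \<pi>) \<longleftrightarrow> (\<exists>\<pi>. bind_pmf \<pi> step = \<pi>)"
    using aloha_stationary_swap by blast
  have "lam2 < s2 \<and> lam1 < p1 * (1 - lam2 / (1 - p1)) \<or> lam1 < s1 \<and> lam2 < p2 * (1 - lam1 / (1 - p2))"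
    if stat: "bind_pmf \<pi> step = \<pi>" for \<pi>
  proof -
    note lt = stationary_lt[OF stat]
    show ?thesis
    proof (cases "lam1 = 0 \<or> lam2 = 0")
      case True
      then show ?thesis using lt s1 s2 by auto
    next
      case False
      then have pos: "0 < lam1" "0 < lam2" using lam1 lam2 by auto
      consider "lam2 < s2" | "lam1 < s1" | "s1 \<le> lam1" "s2 \<le> lam2" by linarith
      then show ?thesis
      proof cases
        case 1
        then show ?thesis using not_stationary_strip[of \<pi>] stat lt pos by force
      next
        case 2
        then show ?thesis
          using sw.not_stationary_strip aloha_stationary_swap[OF stat] lt pos unfolding sw by force
      next
        case 3
        then show ?thesis using not_stationary_corner stat lt by blast
      qed
    qed
  qed
  moreover have "\<exists>\<pi>. bind_pmf \<pi> step = \<pi>"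
    if "lam2 < s2 \<and> lam1 < p1 * (1 - lam2 / (1 - p1)) \<or> lam1 < s1 \<and> lam2 < p2 * (1 - lam1 / (1 - p2))"
    using that stationary_exists sw.stationary_exists unfolding sw swap by blast
  ultimately show ?thesis unfolding stable_iff by blast
qed

end

lemma SR_model_iff:
  assumes "0 < p1" "p1 < 1" "0 < p2" "p2 < 1"
  shows "(lam1, lam2) \<in> SR_model p1 p2 \<longleftrightarrow> lam1 \<in> {0..1} \<and> lam2 \<in> {0..1} \<and>
    (lam2 < p2 * (1 - p1) \<and> lam1 < p1 * (1 - lam2 / (1 - p1)) \<or>
     lam1 < p1 * (1 - p2) \<and> lam2 < p2 * (1 - lam1 / (1 - p2)))"
proof (cases "lam1 \<in> {0..1} \<and> lam2 \<in> {0..1}")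
  case True
  define L1 L2 where "L1 = p1 * (1 - lam2 / (1 - p1))" and "L2 = p2 * (1 - lam1 / (1 - p2))"
  \<comment> \<open>Each border reaches its constant branch at the corner
    \<open>(p1 * (1 - p2), p2 * (1 - p1))\<close> and never falls below that constant; so
    \<open>lam2 < p2 * (1 - p1)\<close> implies the second inequality of the model, and
    symmetrically.\<close>
  have "p1 * (1 - p2) \<le> L1 \<longleftrightarrow> lam2 \<le> p2 * (1 - p1)" "p2 * (1 - p1) \<le> L2 \<longleftrightarrow> lam1 \<le> p1 * (1 - p2)"
    "p1 * (1 - p2) < L1 \<longleftrightarrow> lam2 < p2 * (1 - p1)" "p2 * (1 - p1) < L2 \<longleftrightarrow> lam1 < p1 * (1 - p2)"
    using assms by (auto simp: L1_def L2_def divide_le_eq divide_less_eq)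
  moreover have "lam_SR lam1 p1 lam2 p2 = (if lam2 \<le> p2 * (1 - p1) then L1 else p1 * (1 - p2))"
    "lam_SR lam2 p2 lam1 p1 = (if lam1 \<le> p1 * (1 - p2) then L2 else p2 * (1 - p1))"
    using assms True by (simp_all add: lam_SR_eq L1_def L2_def)
  ultimately show ?thesis
    using True unfolding L1_def[symmetric] L2_def[symmetric] by (auto simp: SR_model_def)
qed (auto simp: SR_model_def)

text \<open>Both border lines pass through that corner, and \<open>p1 + p2 \<le> 1\<close> makes the
  first at least as steep; so below the corner its left side lies under the second line.\<close>

lemma triangle_cut:
  fixes p1 p2 lam1 lam2 :: real
  assumes "0 < p1" "p1 < 1" "0 < p2" "p2 < 1" "p1 + p2 \<le> 1"
    and l2: "lam2 < p2 * (1 - p1)" and l1: "lam1 < p1 * (1 - lam2 / (1 - p1))"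
  shows "lam2 < p2 * (1 - lam1 / (1 - p2))"
proof -
  have "(1 - p1) * lam1 < p1 * (1 - p1) - p1 * lam2"
    using l1 assms by (simp add: field_simps)
  then have "p2 * ((1 - p1) * lam1) < p2 * (p1 * (1 - p1) - p1 * lam2)" using assms by simp
  moreover have "0 \<le> (1 - p1 - p2) * (p2 * (1 - p1) - lam2)" using assms by simp
  ultimately have "(1 - p1) * (p2 * lam1) < (1 - p1) * (p2 * (1 - p2) - (1 - p2) * lam2)"
    by (simp add: algebra_simps)
  then have "p2 * lam1 < p2 * (1 - p2) - (1 - p2) * lam2" using assms by simp
  then show ?thesis using assms by (simp add: field_simps)
qed

text \<open>The linear formula is claimed up to the load at which the other node saturates. In
  general the region is a union of two pieces; for \<open>p1 + p2 \<le> 1\<close> this union is the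
  stated intersection.\<close>

theorem mainTheorem6:
  fixes p1 p2 :: real
  assumes "0 < p1" "p1 < 1" "0 < p2" "p2 < 1"
  shows "(\<forall>lam1\<in>{0..1}. \<forall>lam2\<in>{0..1}. lam2 \<le> p2 * (1 - p1) \<longrightarrow>
            lam_SR lam1 p1 lam2 p2 = p1 * (1 - lam2 / (1 - p1))) \<and>
         (\<forall>lam1\<in>{0..1}. \<forall>lam2\<in>{0..1}. lam1 \<le> p1 * (1 - p2) \<longrightarrow>
            lam_SR lam2 p2 lam1 p1 = p2 * (1 - lam1 / (1 - p2))) \<and>
         (p1 + p2 \<le> 1 \<longrightarrow>
            SR_model p1 p2 = {(lam1, lam2). lam1 \<in> {0..1} \<and> lam2 \<in> {0..1} \<and>
              lam1 < p1 * (1 - lam2 / (1 - p1)) \<and> lam2 < p2 * (1 - lam1 / (1 - p2))}) \<and>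
         SR_model p1 p2 = SR_exact p1 p2"
proof (intro conjI ballI impI)
  fix lam1 lam2 :: real
  assume "lam1 \<in> {0..1}" "lam2 \<in> {0..1}"
  then show "lam2 \<le> p2 * (1 - p1) \<Longrightarrow> lam_SR lam1 p1 lam2 p2 = p1 * (1 - lam2 / (1 - p1))"
    "lam1 \<le> p1 * (1 - p2) \<Longrightarrow> lam_SR lam2 p2 lam1 p1 = p2 * (1 - lam1 / (1 - p2))"
    using assms lam_SR_eq[of p1 p2 lam1 lam2] lam_SR_eq[of p2 p1 lam2 lam1] by auto
next
  assume sum: "p1 + p2 \<le> 1"
  have "(lam2 < p2 * (1 - p1) \<and> lam1 < p1 * (1 - lam2 / (1 - p1)) \<or>
      lam1 < p1 * (1 - p2) \<and> lam2 < p2 * (1 - lam1 / (1 - p2))) \<longleftrightarrow>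
    lam1 < p1 * (1 - lam2 / (1 - p1)) \<and> lam2 < p2 * (1 - lam1 / (1 - p2))" for lam1 lam2
  proof -
    have "lam2 < p2 * (1 - p1) \<or> lam1 < p1 * (1 - p2)" if "lam1 < p1 * (1 - lam2 / (1 - p1))"
    proof (rule ccontr)
      assume "\<not> (lam2 < p2 * (1 - p1) \<or> lam1 < p1 * (1 - p2))"
      then have "p2 \<le> lam2 / (1 - p1)" "p1 * (1 - p2) \<le> lam1" using assms by (auto simp: le_divide_eq)
      moreover from this have "p1 * (1 - lam2 / (1 - p1)) \<le> p1 * (1 - p2)" using assms by simp
      ultimately show False using that by linarith
    qed
    moreover have "lam2 < p2 * (1 - p1) \<Longrightarrow> lam1 < p1 * (1 - lam2 / (1 - p1)) \<Longrightarrow> lam2 < p2 * (1 - lam1 / (1 - p2))"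
      using triangle_cut[OF assms sum] .
    moreover have "lam1 < p1 * (1 - p2) \<Longrightarrow> lam2 < p2 * (1 - lam1 / (1 - p2)) \<Longrightarrow> lam1 < p1 * (1 - lam2 / (1 - p1))"
      using triangle_cut[of p2 p1 lam1 lam2] assms sum by (simp add: add.commute)
    ultimately show ?thesis by blast
  qed
  then show "SR_model p1 p2 = {(lam1, lam2). lam1 \<in> {0..1} \<and> lam2 \<in> {0..1} \<and>
      lam1 < p1 * (1 - lam2 / (1 - p1)) \<and> lam2 < p2 * (1 - lam1 / (1 - p2))}"
    by (intro set_eqI) (simp add: SR_model_iff[OF assms] split: prod.split)
next
  have "aloha_stable lam1 p1 lam2 p2 \<longleftrightarrow>
      lam2 < p2 * (1 - p1) \<and> lam1 < p1 * (1 - lam2 / (1 - p1)) \<or>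
      lam1 < p1 * (1 - p2) \<and> lam2 < p2 * (1 - lam1 / (1 - p2))"
    if l: "lam1 \<in> {0..1}" "lam2 \<in> {0..1}" for lam1 lam2
  proof -
    interpret aloha lam1 p1 lam2 p2
      using assms l by unfold_locales auto
    show ?thesis using stable_region by (simp add: s1_def s2_def)
  qed
  then have "q \<in> SR_model p1 p2 \<longleftrightarrow> q \<in> SR_exact p1 p2" for q
    by (cases q) (auto simp: SR_model_iff[OF assms] SR_exact_def)
  then show "SR_model p1 p2 = SR_exact p1 p2" by blast
qed

end
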